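(* Let $A \subset \mathbb{R}$ be finite. Then $$|AA| + |A+A| \gtrsim |A|^{4/3 + 5/5277}.$$
   Context: For finite $A,B\subset\mathbb{R}$, $A+B=\{a+b: a\in A, b\in B\}$ and $AB=\{ab : a\in A, b\in B\}$. The notation $b \gtrsim a$ (equivalently $a \lesssim b$) means $a = O(b \log^c |A|)$ for some absolute constant $c>0$. *)

theory Defs
  imports Complex_Main "HOL-Library.Set_Algebras"
begin

text \<open>
  The sum set and the product set are the operations \<open>A + B\<close> and \<open>A * B\<close> on sets
  from \<^theory>\<open>HOL-Library.Set_Algebras\<close>.
\<close>

end

theory Submission
  imports Defs "HOL-Analysis.Analysis"
begin

text \<open>
  Write \<open>n = |A|\<close>, \<open>P = |AA|\<close>, \<open>Q = |A + A|\<close>, \<open>L = 1 + ln n\<close>; we may take \<open>A\<close> positive. The bound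
  proved is \<open>n^399 \<le> C L^138 P^119 Q^180\<close>, which gives the exponent
  \<open>399/299 = 4/3 + 1/897 > 4/3 + 5/5277\<close>.

  Choose a level set \<open>S\<close> of slopes \<open>\<mu>\<close> with \<open>\<tau>\<close> points of \<open>A \<times> A\<close> each and \<open>|S| \<tau>\<^sup>2\<close> of the order of
  \<open>n\<^sup>4 / P\<close>. Solymosi adds points on consecutive lines through the origin; following Konyagin and
  Shkredov one adds points on any two of \<open>M\<close> consecutive lines. Unless this already improves
  Solymosi's bound there are many coincidences, so that for at least half of the slopes the set
  \<open>X\<close> of abscissae satisfies \<open>\<alpha>x + \<beta>y = \<gamma>z\<close> for at least a proportion \<open>4 / M\<^sup>2\<close> of the pairs in
  \<open>X \<times> Y\<close>, where \<open>X\<close>, \<open>Y\<close>, \<open>Z\<close> have the same size. A bound for rich lines in a Cartesian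
  product then shows that the (weighted) multiplicative energy of such an \<open>X\<close> is small, hence
  that \<open>AX\<close> contains many popular products \<open>p\<close>, for which also \<open>\<mu>p \<in> AA\<close>. Consequently a large
  \<open>B \<subseteq> A\<close> consists of elements with many representations as a quotient of an element of
  \<open>AA\<close> by an element of a dilate of \<open>S\<close>. For such \<open>B\<close> the third moment of the number of
  representations of a sum is controlled by incidences, and the argument of Schoen and Shkredov
  makes \<open>B + B\<close> larger than incidences alone would allow.
\<close>

section \<open>Counting tools\<close>

text \<open>Group by the fibres of \<open>f\<close> and apply Cauchy-Schwarz to the fibre weights.
  The last factor is the weighted number of collisions of \<open>f\<close>.\<close>

lemma weighted_cauchy_schwarz:
  fixes w :: "'a \<Rightarrow> real"
  assumes I: "finite I"
  shows "(\<Sum>i\<in>I. w i)\<^sup>2 \<le> real (card (f ` I)) * (\<Sum>i\<in>I. w i * (\<Sum>j\<in>{j\<in>I. f j = f i}. w j))"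
proof -
  define W where "W y = (\<Sum>i\<in>{i\<in>I. f i = y}. w i)" for y
  have "(\<Sum>i\<in>I. w i) = (\<Sum>y\<in>f ` I. W y)"
    unfolding W_def by (rule sum.image_gen[OF I])
  moreover have "(\<Sum>i\<in>I. w i * W (f i)) = (\<Sum>y\<in>f ` I. (W y)\<^sup>2)"
  proof -
    have "(\<Sum>i\<in>I. w i * W (f i)) = (\<Sum>y\<in>f ` I. \<Sum>i\<in>{i\<in>I. f i = y}. w i * W (f i))"
      by (rule sum.image_gen[OF I])
    also have "\<dots> = (\<Sum>y\<in>f ` I. (W y)\<^sup>2)"
    proof (rule sum.cong[OF refl])
      fix y
      have "(\<Sum>i\<in>{i\<in>I. f i = y}. w i * W (f i)) = (\<Sum>i\<in>{i\<in>I. f i = y}. w i * W y)"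
        by (rule sum.cong) auto
      also have "\<dots> = W y * W y"
        by (simp add: W_def sum_distrib_right)
      finally show "(\<Sum>i\<in>{i\<in>I. f i = y}. w i * W (f i)) = (W y)\<^sup>2"
        by (simp add: power2_eq_square)
    qed
    finally show ?thesis .
  qed
  ultimately show ?thesis
    using sum_squared_le_sum_of_squares[of W "f ` I"]
    by (simp add: W_def mult.commute)
qed

text \<open>Unit weights. A small image forces many collisions (cells, sum sets, product sets), and
  few collisions force a large image (cluster sums).\<close>

lemma card_cauchy_schwarz:
  assumes I: "finite I"
  shows "(card I)\<^sup>2 \<le> card (f ` I) * card {(i, j). i \<in> I \<and> j \<in> I \<and> f j = f i}"
proof -
  have eq: "{(i, j). i \<in> I \<and> j \<in> I \<and> f j = f i} = Sigma I (\<lambda>i. {j\<in>I. f j = f i})" by auto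
  have "(real (card I))\<^sup>2 \<le> real (card (f ` I)) * real (card {(i, j). i \<in> I \<and> j \<in> I \<and> f j = f i})"
    unfolding eq using weighted_cauchy_schwarz[OF I, of "\<lambda>_. 1" f] I by (simp add: card_SigmaI)
  then show ?thesis by (simp flip: of_nat_power of_nat_mult)
qed

lemma harm_le_ln: "n \<ge> 1 \<Longrightarrow> harm n \<le> 1 + ln (real n)"
proof (induction n rule: nat_induct_at_least)
  case base then show ?case by (simp add: harm_expand)
next
  case (Suc n)
  \<comment> \<open>This is ln(1 - x) <= -x at x = 1 / (n + 1), because 1 - x is the reciprocal of 1
    + 1 / n; the left side is x itself.\<close>
  have "1 - 1 / (1 + 1 / real n) \<le> ln (1 + 1 / real n)"
    using Suc ln_one_minus_pos_upper_bound[of "1 / (real n + 1)"]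
    by (simp add: field_simps ln_div)
  also have "1 - 1 / (1 + 1 / real n) = 1 / real (Suc n)" using Suc by (simp add: field_simps)
  also have "ln (1 + 1 / real n) = ln (real (Suc n)) - ln (real n)"
    using Suc ln_div[of "real (Suc n)" "real n"] by (simp add: field_simps)
  finally show ?case using Suc by (simp add: harm_Suc inverse_eq_divide)
qed

lemma power_diff_le:
  fixes t :: nat
  assumes "p \<ge> 1"
  shows "real (Suc t) ^ p - real t ^ p \<le> real p * real (Suc t) ^ (p - 1)"
proof -
  have "real (Suc t) ^ p - real t ^ p = (\<Sum>i<p. real t ^ (p - Suc i) * real (Suc t) ^ i)"
    by (subst power_diff_sumr2) simp
  also have "\<dots> \<le> (\<Sum>i<p. real (Suc t) ^ (p - Suc i) * real (Suc t) ^ i)"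
    by (intro sum_mono mult_right_mono power_mono) auto
  also have "\<dots> = (\<Sum>i<p. real (Suc t) ^ (p - 1))"
    by (intro sum.cong) (auto simp flip: power_add)
  finally show ?thesis by simp
qed

text \<open>Pigeonholing with a harmonic loss. Abel summation turns the p-th moment into at most p
  times the sum of g(u) / u, where g(u) = u^p |{f >= u}|; replacing g(u) by its maximum leaves a
  harmonic sum.\<close>

lemma level_set:
  fixes f :: "'a \<Rightarrow> nat"
  assumes I: "finite I" and N: "N \<ge> 1" and f: "\<And>i. i \<in> I \<Longrightarrow> f i \<le> N" and p: "p \<ge> 1"
  obtains t where "1 \<le> t" "t \<le> N"
    "(\<Sum>i\<in>I. real (f i) ^ p) \<le> real p * harm N * (real t ^ p * real (card {i\<in>I. t \<le> f i}))"
proof -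
  define g where "g t = real t ^ p * real (card {i\<in>I. t \<le> f i})" for t
  obtain t where t: "t \<in> {1..N}" "\<And>u. u \<in> {1..N} \<Longrightarrow> g u \<le> g t"
  proof -
    have "Max (g ` {1..N}) \<in> g ` {1..N}" using N by (intro Max_in) auto
    then obtain t where "t \<in> {1..N}" "Max (g ` {1..N}) = g t" by blast
    moreover have "g u \<le> Max (g ` {1..N})" if "u \<in> {1..N}" for u
      using that by (intro Max_ge) auto
    ultimately show thesis using that by metis
  qed
  have tel: "real m ^ p = (\<Sum>u\<in>{1..m}. real u ^ p - real (u - 1) ^ p)" for m
    using p by (induction m) auto
  have "(\<Sum>i\<in>I. real (f i) ^ p) = (\<Sum>i\<in>I. \<Sum>u\<in>{1..f i}. real u ^ p - real (u - 1) ^ p)"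
    by (intro sum.cong refl tel)
  also have "\<dots> \<le> (\<Sum>i\<in>I. \<Sum>u\<in>{1..f i}. real p * real u ^ (p - 1))"
  proof (intro sum_mono)
    fix i u assume "u \<in> {1..f i}"
    then show "real u ^ p - real (u - 1) ^ p \<le> real p * real u ^ (p - 1)"
      using power_diff_le[OF p, of "u - 1"] by simp
  qed
  also have "\<dots> = (\<Sum>i\<in>I. \<Sum>u\<in>{1..N}. if u \<le> f i then real p * real u ^ (p - 1) else 0)"
  proof (rule sum.cong[OF refl])
    fix i assume "i \<in> I"
    then have eq: "{1..f i} = {u\<in>{1..N}. u \<le> f i}"
      using f[of i] by (auto intro: order_trans)
    show "(\<Sum>u\<in>{1..f i}. real p * real u ^ (p - 1))
        = (\<Sum>u\<in>{1..N}. if u \<le> f i then real p * real u ^ (p - 1) else 0)"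
      unfolding eq by (rule sum.inter_filter) simp
  qed
  also have "\<dots> = (\<Sum>u\<in>{1..N}. \<Sum>i\<in>I. if u \<le> f i then real p * real u ^ (p - 1) else 0)"
    by (rule sum.swap)
  also have "\<dots> = (\<Sum>u\<in>{1..N}. real p * real u ^ (p - 1) * real (card {i\<in>I. u \<le> f i}))"
    using I by (intro sum.cong refl) (simp add: sum.inter_filter[symmetric])
  also have "\<dots> = (\<Sum>u\<in>{1..N}. real p * (inverse (real u) * g u))"
  proof (intro sum.cong refl)
    fix u assume "u \<in> {1..N}"
    then have "real u ^ p = real u * real u ^ (p - 1)" "u \<noteq> 0"
      using p by (auto simp flip: power_Suc)
    then show "real p * real u ^ (p - 1) * real (card {i\<in>I. u \<le> f i}) = real p * (inverse (real u) * g u)"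
      by (simp add: g_def)
  qed
  also have "\<dots> \<le> (\<Sum>u\<in>{1..N}. real p * (inverse (real u) * g t))"
    using t(2) by (intro sum_mono mult_left_mono) auto
  also have "\<dots> = real p * harm N * g t"
    by (simp add: harm_def sum_distrib_left sum_distrib_right mult.assoc)
  finally show thesis using that t(1) by (auto simp: g_def)
qed

section \<open>Blocks of consecutive elements of a finite ordered set\<close>

definition rank_in :: "'a::linorder set \<Rightarrow> 'a \<Rightarrow> nat"
  where "rank_in A a = card {x\<in>A. x < a}"

lemma rank_in_mono: "finite A \<Longrightarrow> a \<le> b \<Longrightarrow> rank_in A a \<le> rank_in A b"
  unfolding rank_in_def by (rule card_mono) auto

lemma rank_in_strict_mono: "finite A \<Longrightarrow> a \<in> A \<Longrightarrow> a < b \<Longrightarrow> rank_in A a < rank_in A b"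
  unfolding rank_in_def by (rule psubset_card_mono) auto

lemma bij_betw_rank_in:
  assumes "finite A"
  shows "bij_betw (rank_in A) A {..<card A}"
proof -
  have inj: "inj_on (rank_in A) A"
    using assms rank_in_strict_mono by (metis inj_onI less_irrefl linorder_neqE)
  have "rank_in A a < card A" if "a \<in> A" for a
    unfolding rank_in_def using assms that by (intro psubset_card_mono) auto
  then have "rank_in A ` A \<subseteq> {..<card A}" by auto
  then have "rank_in A ` A = {..<card A}"
    using inj by (intro card_subset_eq) (auto simp: card_image)
  with inj show ?thesis by (simp add: bij_betw_def)
qed

lemma card_rank_in_div:
  assumes A: "finite A" and h: "h > 0"
  shows "card {a\<in>A. rank_in A a div h = v} = card {k. k < card A \<and> k div h = v}"
proof (rule bij_betw_same_card[of "rank_in A"])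
  show "bij_betw (rank_in A) {a\<in>A. rank_in A a div h = v} {k. k < card A \<and> k div h = v}"
    using bij_betw_rank_in[OF A] unfolding bij_betw_def
    by (auto intro: inj_on_subset simp: image_iff)
qed

lemma div_fibre:
  assumes "(h::nat) > 0"
  shows "{k. k div h = v} = {v * h..<v * h + h}"
proof (intro set_eqI iffI)
  fix k assume "k \<in> {k. k div h = v}"
  then show "k \<in> {v * h..<v * h + h}"
    using assms div_times_less_eq_dividend[of k h] dividend_less_div_times[of h k] by auto
next
  fix k assume "k \<in> {v * h..<v * h + h}"
  then show "k \<in> {k. k div h = v}"
    using assms by (auto intro!: div_nat_eqI simp: mult.commute)
qed

text \<open>Cells are blocks of \<open>h\<close> consecutive ranks. The rank is defined on the whole
  type, so \<open>f\<close> is monotone everywhere, and a chain in the plane meets the cells in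
  order.\<close>

lemma mono_cells:
  fixes A :: "'a::linorder set"
  assumes A: "finite A" and s: "1 \<le> s" "s \<le> card A"
  obtains f :: "'a \<Rightarrow> nat" where "mono f" "\<And>a. a \<in> A \<Longrightarrow> f a < s"
    "\<And>v. s * card {a\<in>A. f a = v} \<le> 2 * card A"
proof
  \<comment> \<open>The \<open>+ 1\<close> makes \<open>s * h\<close> exceed \<open>card A\<close>,
    so \<open>s\<close> blocks suffice; as \<open>s \<le> card A\<close>, still
    \<open>s * h \<le> 2 * card A\<close>.\<close>
  define h where "h = card A div s + 1"
  have h: "h > 0" by (simp add: h_def)
  show "mono (\<lambda>a. rank_in A a div h)"
    using A by (intro monoI div_le_mono rank_in_mono)
  have big: "card A < s * h"
    using s dividend_less_div_times[of s "card A"] by (simp add: h_def algebra_simps)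
  show "rank_in A a div h < s" if "a \<in> A" for a
  proof -
    have "rank_in A a < card A" using bij_betw_rank_in[OF A] that by (auto simp: bij_betw_def)
    then show ?thesis using big by (simp add: less_mult_imp_div_less)
  qed
  show "s * card {a\<in>A. rank_in A a div h = v} \<le> 2 * card A" for v
  proof -
    have "{k. k < card A \<and> k div h = v} \<subseteq> {v * h..<v * h + h}"
      using div_fibre[OF h, of v] by blast
    then have "card {k. k < card A \<and> k div h = v} \<le> h"
      using card_mono[OF finite_atLeastLessThan, of _ "v * h" "v * h + h"] by simp
    then have "card {a\<in>A. rank_in A a div h = v} \<le> h"
      by (simp add: card_rank_in_div[OF A h])
    then have "s * card {a\<in>A. rank_in A a div h = v} \<le> s * h" by simp
    also have "\<dots> = s * (card A div s) + s" by (simp add: h_def)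
    also have "\<dots> \<le> 2 * card A" using s times_div_less_eq_dividend[of s "card A"] by linarith
    finally show ?thesis .
  qed
qed

section \<open>Rich lines in a Cartesian product\<close>

text \<open>The pair \<open>(m, c)\<close> stands for the line \<open>y = m x + c\<close>; only abscissae are recorded.\<close>

definition line_pts :: "real set \<Rightarrow> real set \<Rightarrow> real \<times> real \<Rightarrow> real set"
  where "line_pts A B = (\<lambda>(m, c). {x\<in>A. m * x + c \<in> B})"

lemma finite_line_pts [simp]: "finite A \<Longrightarrow> finite (line_pts A B l)"
  by (auto simp: line_pts_def split: prod.split)

lemma card_line_pts_le:
  assumes "finite A" "finite B" "fst l \<noteq> 0"
  shows "card (line_pts A B l) \<le> card A" "card (line_pts A B l) \<le> card B"
proof -
  obtain m c where l: "l = (m, c)" by fastforce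
  show "card (line_pts A B l) \<le> card A"
    using assms by (auto simp: l line_pts_def intro: card_mono)
  show "card (line_pts A B l) \<le> card B"
    using assms by (intro card_inj_on_le[of "\<lambda>x. m * x + c"]) (auto simp: l line_pts_def inj_on_def)
qed

text \<open>Cut \<open>A\<close> and \<open>B\<close> into \<open>s\<close> consecutive blocks each. A line of positive slope is a chain, so it meets
  fewer than \<open>2 s\<close> of the \<open>s\<^sup>2\<close> cells, and if it has at least \<open>4 s\<close> points then many pairs of them
  share a cell; but two points lie on only one line. For Cartesian products this replaces the
  Szemeredi-Trotter theorem.\<close>

lemma rich_lines:
  fixes A B :: "real set"
  assumes A: "finite A" and B: "finite B" and L: "finite L"
    and pos: "\<And>l. l \<in> L \<Longrightarrow> fst l > 0"
    and s: "s \<ge> 1" and rich: "\<And>l. l \<in> L \<Longrightarrow> 4 * s \<le> card (line_pts A B l)"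
  shows "s * (\<Sum>l\<in>L. (card (line_pts A B l))\<^sup>2) \<le> 16 * (card A)\<^sup>2 * (card B)\<^sup>2"
proof (cases "L = {}")
  case True then show ?thesis by simp
next
  case False
  then obtain l0 where l0: "l0 \<in> L" by blast
  have "4 * s \<le> card A" "4 * s \<le> card B"
    using card_line_pts_le[OF A B, of l0] rich[OF l0] pos[OF l0] by linarith+
  then have sA: "s \<le> card A" and sB: "s \<le> card B" by auto
  obtain f where f: "mono f" "\<And>a. a \<in> A \<Longrightarrow> f a < s" "\<And>v::nat. s * card {a\<in>A. f a = v} \<le> 2 * card A"
    using mono_cells[OF A s sA] by blast
  obtain g where g: "mono g" "\<And>a. a \<in> B \<Longrightarrow> g a < s" "\<And>v::nat. s * card {a\<in>B. g a = v} \<le> 2 * card B"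
    using mono_cells[OF B s sB] by blast
  define D where "D = (\<lambda>(m, c). {(x, x'). x \<in> A \<and> x' \<in> A \<and> x \<noteq> x' \<and> f x = f x' \<and>
     m * x + c \<in> B \<and> m * x' + c \<in> B \<and> g (m * x + c) = g (m * x' + c)})"
  have finD: "finite (D l)" for l
    using A by (intro finite_subset[of "D l" "A \<times> A"]) (auto simp: D_def split: prod.splits)
  have line: "(card (line_pts A B l))\<^sup>2 \<le> 4 * s * card (D l)" if l: "l \<in> L" for l
  proof -
    obtain m c where mc: "l = (m, c)" by fastforce
    have m: "m > 0" using pos[OF l] mc by simp
    define I where "I = line_pts A B l"
    have I: "finite I" using A by (simp add: I_def)
    \<comment> \<open>Along a line of positive slope both block indices increase weakly, so equal
      sums force equal indices: \<open>v\<close> identifies the cell while taking fewer than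
      \<open>2 * s\<close> values.\<close>
    define v where "v x = f x + g (m * x + c)" for x
    have cell: "f x = f y \<and> g (m * x + c) = g (m * y + c)" if "v x = v y" "x \<le> y" for x y
    proof -
      have "f x \<le> f y" "g (m * x + c) \<le> g (m * y + c)"
        using m that(2) by (auto intro!: monoD[OF f(1)] monoD[OF g(1)])
      then show ?thesis using that(1) by (auto simp: v_def)
    qed
    have "{(x, y). x \<in> I \<and> y \<in> I \<and> v y = v x} \<subseteq> D l \<union> (\<lambda>x. (x, x)) ` I"
    proof (rule subsetI)
      fix p assume "p \<in> {(x, y). x \<in> I \<and> y \<in> I \<and> v y = v x}"
      then obtain x y where p: "p = (x, y)" and 1: "x \<in> I" "y \<in> I" "v y = v x" by blast
      have "f x = f y \<and> g (m * x + c) = g (m * y + c)"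
      proof (cases "x \<le> y")
        case True
        show ?thesis by (rule cell[OF sym[OF 1(3)] True])
      next
        case False
        then show ?thesis using cell[OF 1(3)] by simp
      qed
      then show "p \<in> D l \<union> (\<lambda>x. (x, x)) ` I"
        using 1 by (auto simp: p I_def line_pts_def D_def mc)
    qed
    then have "card {(x, y). x \<in> I \<and> y \<in> I \<and> v y = v x} \<le> card (D l \<union> (\<lambda>x. (x, x)) ` I)"
      using finD I by (intro card_mono) auto
    also have "\<dots> \<le> card (D l) + card I"
      using card_Un_le[of "D l" "(\<lambda>x. (x, x)) ` I"] card_image_le[OF I, of "\<lambda>x. (x, x)"] by linarith
    finally have coll: "card {(x, y). x \<in> I \<and> y \<in> I \<and> v y = v x} \<le> card (D l) + card I" .
    have "v ` I \<subseteq> {..<2 * s}"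
      using f(2) g(2) by (fastforce simp: I_def line_pts_def mc v_def)
    then have "card (v ` I) \<le> 2 * s"
      using card_mono[of "{..<2 * s}" "v ` I"] by simp
    then have "(card I)\<^sup>2 \<le> 2 * s * (card (D l) + card I)"
      using card_cauchy_schwarz[OF I, of v] coll by (meson le_trans mult_le_mono)
    then have "card I * card I \<le> 2 * (s * card (D l)) + 2 * (s * card I)"
      by (simp add: power2_eq_square algebra_simps)
    \<comment> \<open>Richness absorbs the diagonal pairs: 2 s |I| is at most half of |I|^2.\<close>
    moreover have "4 * (s * card I) \<le> card I * card I"
      using mult_le_mono1[OF rich[OF l], of "card I"] by (simp add: I_def mult.assoc)
    ultimately show ?thesis
      unfolding I_def[symmetric] power2_eq_square by linarith
  qed
  define E where "E = {((x, y), (x', y')). x \<in> A \<and> x' \<in> A \<and> y \<in> B \<and> y' \<in> B \<and> f x = f x' \<and> g y = g y'}"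
  define \<phi> where "\<phi> = (\<lambda>((m::real, c::real), x, x'). ((x, m * x + c), (x', m * x' + c)))"
  have finE: "finite E"
    using A B by (intro finite_subset[of E "(A \<times> B) \<times> (A \<times> B)"]) (auto simp: E_def)
  have "(\<Sum>l\<in>L. card (D l)) = card (Sigma L D)"
    using L finD by simp
  also have "\<dots> \<le> card E"
  \<comment> \<open>Two distinct points determine the line, so no pair of grid points is counted for
    two lines.\<close>
  proof (rule card_inj_on_le[of \<phi>])
    show "inj_on \<phi> (Sigma L D)"
    proof (rule inj_onI)
      fix p q assume p: "p \<in> Sigma L D" and q: "q \<in> Sigma L D" and eq: "\<phi> p = \<phi> q"
      obtain m c x x' where p': "p = ((m, c), x, x')" by (metis surj_pair)
      obtain m' c' y y' where q': "q = ((m', c'), y, y')" by (metis surj_pair)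
      have xy: "y = x" "y' = x'" "m * x + c = m' * x + c'" "m * x' + c = m' * x' + c'"
        using eq by (auto simp: \<phi>_def p' q')
      have "x \<noteq> x'" using p by (auto simp: p' D_def)
      moreover have "(m - m') * (x - x') = 0" using xy(3,4) by (simp add: algebra_simps)
      ultimately show "p = q" using xy by (simp add: p' q')
    qed
    show "\<phi> ` Sigma L D \<subseteq> E" by (auto simp: \<phi>_def D_def E_def)
    show "finite E" by (rule finE)
  qed
  finally have le: "(\<Sum>l\<in>L. card (D l)) \<le> card E" .
  have cnt: "s * card {(x, x'). x \<in> X \<and> x' \<in> X \<and> h x = h x'} \<le> 2 * (card X)\<^sup>2"
    if "finite X" "\<And>v::nat. s * card {a\<in>X. h a = v} \<le> 2 * card X" for X :: "real set" and h
  proof -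
    have "{(x, x'). x \<in> X \<and> x' \<in> X \<and> h x = h x'} = Sigma X (\<lambda>x. {a\<in>X. h a = h x})" by auto
    then have "s * card {(x, x'). x \<in> X \<and> x' \<in> X \<and> h x = h x'} = (\<Sum>x\<in>X. s * card {a\<in>X. h a = h x})"
      using that(1) by (simp add: sum_distrib_left)
    also have "\<dots> \<le> (\<Sum>x\<in>X. 2 * card X)" using that(2) by (intro sum_mono) auto
    finally show ?thesis by (simp add: power2_eq_square)
  qed
  have "card E \<le> card ({(x, x'). x \<in> A \<and> x' \<in> A \<and> f x = f x'} \<times> {(y, y'). y \<in> B \<and> y' \<in> B \<and> g y = g y'})"
  proof (rule card_inj_on_le[of "\<lambda>((x, y), (x', y')). ((x, x'), (y, y'))"])
    show "finite ({(x, x'). x \<in> A \<and> x' \<in> A \<and> f x = f x'} \<times> {(y, y'). y \<in> B \<and> y' \<in> B \<and> g y = g y'})"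
      using A B by (intro finite_cartesian_product
          finite_subset[of "{(x, x'). x \<in> A \<and> x' \<in> A \<and> f x = f x'}" "A \<times> A"]
          finite_subset[of "{(y, y'). y \<in> B \<and> y' \<in> B \<and> g y = g y'}" "B \<times> B"]) auto
  qed (auto simp: E_def inj_on_def)
  then have "s\<^sup>2 * card E \<le> (s * card {(x, x'). x \<in> A \<and> x' \<in> A \<and> f x = f x'})
      * (s * card {(y, y'). y \<in> B \<and> y' \<in> B \<and> g y = g y'})"
    by (simp add: card_cartesian_product power2_eq_square algebra_simps)
  also have "\<dots> \<le> (2 * (card A)\<^sup>2) * (2 * (card B)\<^sup>2)"
    by (intro mult_le_mono cnt A B f(3) g(3))
  finally have E4: "s\<^sup>2 * card E \<le> 4 * ((card A)\<^sup>2 * (card B)\<^sup>2)" by simp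
  have "s * (\<Sum>l\<in>L. (card (line_pts A B l))\<^sup>2) \<le> s * (\<Sum>l\<in>L. 4 * s * card (D l))"
    using line by (intro mult_le_mono2 sum_mono) auto
  also have "\<dots> = 4 * (s\<^sup>2 * (\<Sum>l\<in>L. card (D l)))"
    by (simp add: power2_eq_square mult_ac sum_distrib_left)
  also have "\<dots> \<le> 4 * (s\<^sup>2 * card E)" by (intro mult_le_mono2 le)
  also have "\<dots> \<le> 4 * (4 * ((card A)\<^sup>2 * (card B)\<^sup>2))" by (intro mult_le_mono2 E4)
  finally show ?thesis by simp
qed

section \<open>Slopes with a large weighted number of representations\<close>

lemma double_count:
  assumes "finite A" "finite B"
  shows "(\<Sum>x\<in>A. card {y\<in>B. P x y}) = (\<Sum>y\<in>B. card {x\<in>A. P x y})"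
  using sum.swap_restrict[OF assms, of "\<lambda>_ _. 1::nat" P] by simp

text \<open>With \<beta> Y and \<gamma> Z in place of \<open>Y\<close> and \<open>D\<close>, \<beta>
  nonzero, this is the number of y in Y with \<alpha> x + \<beta> y in \<gamma> Z.\<close>

definition sum_weight :: "real set \<Rightarrow> real set \<Rightarrow> real \<Rightarrow> real \<Rightarrow> nat"
  where "sum_weight Y D \<alpha> x = card {y\<in>Y. y + \<alpha> * x \<in> D}"

text \<open>For constant weight 1 and \<open>X\<close> without 0, this is the number of
  representations of \<mu> as a quotient in \<open>X\<close>, whose squares sum to the
  multiplicative energy.\<close>

definition weighted_ratio :: "real set \<Rightarrow> (real \<Rightarrow> nat) \<Rightarrow> real \<Rightarrow> nat"
  where "weighted_ratio X w \<mu> = (\<Sum>x\<in>{x\<in>X. \<mu> * x \<in> X}. w x * w (\<mu> * x))"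

lemma sum_weight_le: "finite Y \<Longrightarrow> sum_weight Y D \<alpha> x \<le> card Y"
  unfolding sum_weight_def by (rule card_mono) auto

text \<open>For \<open>y, y' \<in> Y\<close> the points \<open>(y + \<alpha>x, y' + \<alpha>\<mu>x)\<close> that lie in \<open>D \<times> D\<close> are on one line of slope \<open>\<mu>\<close>
  through \<open>(y, y')\<close>, so a slope with a large weighted ratio yields many rich lines.\<close>

lemma weighted_ratio_level:
  fixes X Y D \<Theta> :: "real set"
  assumes fin: "finite X" "finite Y" "finite D" "finite \<Theta>"
    and card: "card X \<le> \<tau>" "card Y \<le> \<tau>" "card D \<le> \<tau>"
    and X0: "0 \<notin> X" and \<alpha>: "\<alpha> \<noteq> 0" and pos: "\<And>\<mu>. \<mu> \<in> \<Theta> \<Longrightarrow> \<mu> > 0"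
    and R: "\<And>\<mu>. \<mu> \<in> \<Theta> \<Longrightarrow> R \<le> weighted_ratio X (sum_weight Y D \<alpha>) \<mu>"
  shows "R\<^sup>2 * card \<Theta> \<le> 8192 * \<tau> ^ 6"
proof -
  define w where "w = sum_weight Y D \<alpha>"
  have p6: "\<tau> ^ 6 = \<tau>\<^sup>2 * (\<tau>\<^sup>2 * \<tau>\<^sup>2)" and p4: "\<tau> ^ 4 = \<tau>\<^sup>2 * \<tau>\<^sup>2"
    by (simp_all flip: power_add)
  define Q where "Q \<mu> = {x\<in>X. \<mu> * x \<in> X}" for \<mu>
  define c where "c \<mu> = (\<lambda>(y, y'). card {x\<in>Q \<mu>. y + \<alpha> * x \<in> D \<and> y' + \<alpha> * (\<mu> * x) \<in> D})" for \<mu>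
  have finQ: "finite (Q \<mu>)" for \<mu> using fin by (simp add: Q_def)
  have r: "weighted_ratio X w \<mu> = (\<Sum>p\<in>Y \<times> Y. c \<mu> p)" for \<mu>
  proof -
    have "weighted_ratio X w \<mu> = (\<Sum>x\<in>Q \<mu>. card {p\<in>Y \<times> Y. fst p + \<alpha> * x \<in> D \<and> snd p + \<alpha> * (\<mu> * x) \<in> D})"
    proof -
      have "w x * w x' = card {p\<in>Y \<times> Y. fst p + \<alpha> * x \<in> D \<and> snd p + \<alpha> * x' \<in> D}" for x x'
      proof -
        have "{p\<in>Y \<times> Y. fst p + \<alpha> * x \<in> D \<and> snd p + \<alpha> * x' \<in> D}
            = {y\<in>Y. y + \<alpha> * x \<in> D} \<times> {y\<in>Y. y + \<alpha> * x' \<in> D}" by auto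
        then show ?thesis by (simp add: w_def sum_weight_def card_cartesian_product)
      qed
      then show ?thesis by (simp add: weighted_ratio_def Q_def)
    qed
    also have "\<dots> = (\<Sum>p\<in>Y \<times> Y. card {x\<in>Q \<mu>. fst p + \<alpha> * x \<in> D \<and> snd p + \<alpha> * (\<mu> * x) \<in> D})"
      using fin finQ by (intro double_count) auto
    also have "\<dots> = (\<Sum>p\<in>Y \<times> Y. c \<mu> p)" by (simp add: c_def case_prod_beta)
    finally show ?thesis .
  qed
  \<comment> \<open>Chosen so that lines with fewer than \<open>4 * s\<close> points account for at
    most half of \<open>R\<close>. For \<open>s = 0\<close> it is enough to count pairs (x, \<mu>
    x), which determine \<mu> because 0 is not in \<open>X\<close>.\<close>
  define s where "s = R div (8 * \<tau>\<^sup>2)"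
  show ?thesis
  proof (cases "s = 0")
    case True
    have "R * card \<Theta> \<le> (\<Sum>\<mu>\<in>\<Theta>. weighted_ratio X w \<mu>)"
      using sum_mono[of \<Theta> "\<lambda>_. R" "weighted_ratio X w"] R by (simp add: w_def mult.commute)
    also have "\<dots> \<le> (\<Sum>\<mu>\<in>\<Theta>. \<tau>\<^sup>2 * card (Q \<mu>))"
    proof (rule sum_mono)
      fix \<mu>
      have "w x * w (\<mu> * x) \<le> \<tau>\<^sup>2" for x
        unfolding power2_eq_square w_def
        by (intro mult_le_mono order_trans[OF sum_weight_le card(2)] fin)
      then have "weighted_ratio X w \<mu> \<le> (\<Sum>x\<in>Q \<mu>. \<tau>\<^sup>2)"
        unfolding weighted_ratio_def Q_def by (intro sum_mono)
      then show "weighted_ratio X w \<mu> \<le> \<tau>\<^sup>2 * card (Q \<mu>)" by (simp add: mult.commute)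
    qed
    also have "\<dots> = \<tau>\<^sup>2 * card (Sigma \<Theta> Q)"
      using fin finQ by (simp add: sum_distrib_left)
    also have "card (Sigma \<Theta> Q) \<le> card (X \<times> X)"
      using X0 fin by (intro card_inj_on_le[of "\<lambda>(\<mu>, x). (x, \<mu> * x)"]) (auto simp: Q_def inj_on_def)
    also have "\<dots> \<le> \<tau>\<^sup>2"
      using card(1) by (simp add: card_cartesian_product power2_eq_square mult_le_mono)
    finally have *: "R * card \<Theta> \<le> \<tau>\<^sup>2 * \<tau>\<^sup>2" by simp
    show ?thesis
    proof (cases "\<tau> = 0")
      case True
      then show ?thesis using * by (simp add: power2_eq_square)
    next
      case False
      then have "R < 8 * \<tau>\<^sup>2" using True by (simp add: s_def div_eq_0_iff)
      then have "R * (R * card \<Theta>) \<le> (8 * \<tau>\<^sup>2) * (\<tau>\<^sup>2 * \<tau>\<^sup>2)"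
        using mult_le_mono[OF less_imp_le *] by blast
      then show ?thesis unfolding p6 power2_eq_square[of R] by (simp only: mult.assoc mult.left_commute)
    qed
  next
    case False
    then have s: "s \<ge> 1" by simp
    then have \<tau>: "\<tau> > 0" by (auto simp: s_def intro: Nat.gr0I)
    have R_ge: "8 * s * \<tau>\<^sup>2 \<le> R"
      using div_times_less_eq_dividend[of R "8 * \<tau>\<^sup>2"] by (simp add: s_def algebra_simps)
    have R_le: "R \<le> 16 * \<tau>\<^sup>2 * s"
    proof -
      have "R < s * (8 * \<tau>\<^sup>2) + 8 * \<tau>\<^sup>2"
        using dividend_less_div_times[of "8 * \<tau>\<^sup>2" R] \<tau> by (simp add: s_def)
      moreover have "8 * \<tau>\<^sup>2 \<le> s * (8 * \<tau>\<^sup>2)" using s by simp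
      ultimately have "R \<le> 2 * (s * (8 * \<tau>\<^sup>2))" by linarith
      then show ?thesis by (simp add: mult_ac)
    qed
    define H where "H \<mu> = {p\<in>Y \<times> Y. 4 * s \<le> c \<mu> p}" for \<mu>
    \<comment> \<open>The base points (y, y') must be grid points too: then at most as many pairs
      give a line as it has grid points, and each line contributes at most the square of its
      richness.\<close>
    define W where "W = Y \<union> D"
    define l where "l = (\<lambda>(\<mu>::real, (y::real, y'::real)). (\<mu>, y' - \<mu> * y))"
    have finH: "finite (H \<mu>)" for \<mu> using fin by (simp add: H_def)
    have finW: "finite W" and cardW: "card W \<le> 2 * \<tau>"
      using fin card card_Un_le[of Y D] by (auto simp: W_def)
    have half: "R \<le> 2 * (\<Sum>p\<in>H \<mu>. c \<mu> p)" if "\<mu> \<in> \<Theta>" for \<mu>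
    proof -
      have "R \<le> (\<Sum>p\<in>Y \<times> Y. c \<mu> p)" using R[OF that] r by (simp add: w_def)
      also have "\<dots> = (\<Sum>p\<in>H \<mu>. c \<mu> p) + (\<Sum>p\<in>Y \<times> Y - H \<mu>. c \<mu> p)"
        using fin by (subst sum.subset_diff[of "H \<mu>"]) (auto simp: H_def)
      also have "(\<Sum>p\<in>Y \<times> Y - H \<mu>. c \<mu> p) \<le> (\<Sum>p\<in>Y \<times> Y - H \<mu>. 4 * s)"
        by (intro sum_mono) (auto simp: H_def)
      also have "\<dots> \<le> (\<Sum>p\<in>Y \<times> Y. 4 * s)"
        using fin by (intro sum_mono2) auto
      also have "\<dots> \<le> 4 * s * \<tau>\<^sup>2"
        using mult_le_mono[OF card(2) card(2)] by (simp add: card_cartesian_product power2_eq_square)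
      finally show ?thesis using R_ge by simp
    qed
    have c_le: "c \<mu> p \<le> card (line_pts W W (l (\<mu>, p)))" if "\<mu> \<in> \<Theta>" for \<mu> p
    proof -
      obtain y y' where p: "p = (y, y')" by fastforce
      show ?thesis unfolding p c_def case_prod_conv
        using \<alpha> finW by (intro card_inj_on_le[of "\<lambda>x. y + \<alpha> * x"])
          (auto simp: inj_on_def line_pts_def l_def W_def algebra_simps)
    qed
    define T where "T = Sigma \<Theta> H"
    have finT: "finite T" using fin finH by (simp add: T_def)
    define L where "L = l ` T"
    have "R * card \<Theta> \<le> 2 * (\<Sum>\<mu>\<in>\<Theta>. \<Sum>p\<in>H \<mu>. c \<mu> p)"
      using sum_mono[of \<Theta> "\<lambda>_. R" "\<lambda>\<mu>. 2 * (\<Sum>p\<in>H \<mu>. c \<mu> p)"] half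
      by (simp add: sum_distrib_left mult.commute)
    also have "(\<Sum>\<mu>\<in>\<Theta>. \<Sum>p\<in>H \<mu>. c \<mu> p) = (\<Sum>(\<mu>, p)\<in>T. c \<mu> p)"
      unfolding T_def using fin finH by (simp add: sum.Sigma)
    also have "\<dots> \<le> (\<Sum>t\<in>T. card (line_pts W W (l t)))"
      using c_le by (intro sum_mono) (auto simp: T_def)
    also have "\<dots> = (\<Sum>k\<in>L. \<Sum>t\<in>{t\<in>T. l t = k}. card (line_pts W W (l t)))"
      unfolding L_def by (rule sum.image_gen[OF finT])
    also have "\<dots> \<le> (\<Sum>k\<in>L. (card (line_pts W W k))\<^sup>2)"
    proof (rule sum_mono)
      fix k
      obtain m b :: real where k: "k = (m, b)" by fastforce
      have "card {t\<in>T. l t = k} \<le> card (line_pts W W k)"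
        using finW by (intro card_inj_on_le[of "\<lambda>(\<mu>, (y, y')). y"])
          (auto simp: inj_on_def line_pts_def l_def W_def k T_def H_def)
      then show "(\<Sum>t\<in>{t\<in>T. l t = k}. card (line_pts W W (l t))) \<le> (card (line_pts W W k))\<^sup>2"
        by (simp add: power2_eq_square)
    qed
    finally have *: "R * card \<Theta> \<le> 2 * (\<Sum>k\<in>L. (card (line_pts W W k))\<^sup>2)" by simp
    have "s * (\<Sum>k\<in>L. (card (line_pts W W k))\<^sup>2) \<le> 16 * (card W)\<^sup>2 * (card W)\<^sup>2"
    proof (rule rich_lines[OF finW finW])
      show "finite L" using finT by (simp add: L_def)
      show "fst k > 0" if "k \<in> L" for k using that pos by (auto simp: L_def T_def l_def)
      show "4 * s \<le> card (line_pts W W k)" if "k \<in> L" for k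
      proof -
        obtain \<mu> p where "k = l (\<mu>, p)" "\<mu> \<in> \<Theta>" "p \<in> H \<mu>"
          using \<open>k \<in> L\<close> by (auto simp: L_def T_def)
        then show ?thesis using c_le[of \<mu> p] by (simp add: H_def)
      qed
      show "s \<ge> 1" by (rule s)
    qed
    also have "\<dots> \<le> 16 * (2 * \<tau>)\<^sup>2 * (2 * \<tau>)\<^sup>2"
      using cardW by (intro mult_le_mono power_mono order_refl) auto
    finally have "s * (\<Sum>k\<in>L. (card (line_pts W W k))\<^sup>2) \<le> 256 * \<tau> ^ 4"
      unfolding p4 by (simp add: power_mult_distrib)
    moreover have "s * (R * card \<Theta>) \<le> s * (2 * (\<Sum>k\<in>L. (card (line_pts W W k))\<^sup>2))"
      by (rule mult_le_mono2[OF *])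
    moreover have "\<dots> = 2 * (s * (\<Sum>k\<in>L. (card (line_pts W W k))\<^sup>2))"
      by (rule mult.left_commute)
    ultimately have "s * (R * card \<Theta>) \<le> 512 * \<tau> ^ 4" by linarith
    then have "16 * \<tau>\<^sup>2 * (s * (R * card \<Theta>)) \<le> 16 * \<tau>\<^sup>2 * (512 * \<tau> ^ 4)"
      by (rule mult_le_mono2)
    also have "\<dots> = 8192 * \<tau> ^ 6" unfolding p6 p4 by simp
    finally have "16 * \<tau>\<^sup>2 * s * (R * card \<Theta>) \<le> 8192 * \<tau> ^ 6"
      by (simp only: mult.assoc)
    moreover have "R * (R * card \<Theta>) \<le> 16 * \<tau>\<^sup>2 * s * (R * card \<Theta>)"
      using R_le by (rule mult_le_mono1)
    ultimately show ?thesis unfolding power2_eq_square[of R] mult.assoc[of R] by (rule le_trans[rotated])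
  qed
qed

text \<open>One level carries the second moment up to a harmonic factor. A weighted ratio has at
  most \<tau> terms, each a product of two weights at most \<tau>, which gives the range
  \<tau>^3.\<close>

lemma weighted_ratio_energy:
  fixes X Y D \<Theta> :: "real set"
  assumes fin: "finite X" "finite Y" "finite D" "finite \<Theta>"
    and card: "card X \<le> \<tau>" "card Y \<le> \<tau>" "card D \<le> \<tau>" and \<tau>: "\<tau> \<ge> 1"
    and X0: "0 \<notin> X" and \<alpha>: "\<alpha> \<noteq> 0" and pos: "\<And>\<mu>. \<mu> \<in> \<Theta> \<Longrightarrow> \<mu> > 0"
  shows "(\<Sum>\<mu>\<in>\<Theta>. (real (weighted_ratio X (sum_weight Y D \<alpha>) \<mu>))\<^sup>2)
    \<le> 16384 * harm (\<tau> ^ 3) * real \<tau> ^ 6"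
proof -
  define r where "r = weighted_ratio X (sum_weight Y D \<alpha>)"
  have le: "r \<mu> \<le> \<tau> ^ 3" for \<mu>
  proof -
    have "sum_weight Y D \<alpha> x * sum_weight Y D \<alpha> (\<mu> * x) \<le> \<tau> * \<tau>" for x
      by (intro mult_le_mono order_trans[OF sum_weight_le card(2)] fin)
    then have "r \<mu> \<le> (\<Sum>x\<in>{x\<in>X. \<mu> * x \<in> X}. \<tau> * \<tau>)"
      unfolding r_def weighted_ratio_def by (intro sum_mono)
    also have "\<dots> \<le> (\<Sum>x\<in>X. \<tau> * \<tau>)" using fin by (intro sum_mono2) auto
    also have "\<dots> \<le> \<tau> * (\<tau> * \<tau>)" using card(1) by simp
    finally show ?thesis by (simp add: eval_nat_numeral)
  qed
  obtain t where t: "1 \<le> t" "t \<le> \<tau> ^ 3"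
    "(\<Sum>\<mu>\<in>\<Theta>. real (r \<mu>) ^ 2) \<le> real 2 * harm (\<tau> ^ 3) * (real t ^ 2 * real (card {\<mu>\<in>\<Theta>. t \<le> r \<mu>}))"
  proof (rule level_set[OF fin(4), of "\<tau> ^ 3" r 2])
    show "1 \<le> \<tau> ^ 3" using \<tau> by simp
  qed (use le in auto)
  have "t\<^sup>2 * card {\<mu>\<in>\<Theta>. t \<le> r \<mu>} \<le> 8192 * \<tau> ^ 6"
  proof (rule weighted_ratio_level[OF fin(1-3) _ card X0 \<alpha>])
    show "finite {\<mu>\<in>\<Theta>. t \<le> r \<mu>}" using fin by simp
  qed (use pos in \<open>auto simp: r_def\<close>)
  then have "real (t\<^sup>2 * card {\<mu>\<in>\<Theta>. t \<le> r \<mu>}) \<le> real (8192 * \<tau> ^ 6)"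
    by (rule of_nat_mono)
  then have "real t ^ 2 * real (card {\<mu>\<in>\<Theta>. t \<le> r \<mu>}) \<le> 8192 * real \<tau> ^ 6"
    by simp
  then have "2 * harm (\<tau> ^ 3) * (real t ^ 2 * real (card {\<mu>\<in>\<Theta>. t \<le> r \<mu>}))
      \<le> 2 * harm (\<tau> ^ 3) * (8192 * real \<tau> ^ 6)"
    by (intro mult_left_mono) (simp_all add: harm_nonneg)
  with t(3) show ?thesis by (simp add: r_def)
qed

section \<open>Sums of points on clusters of lines through the origin\<close>

text \<open>Vector sums of (x, \<kappa> x) and (y, \<mu> y), points on two different lines through
  the origin; \<open>X \<kappa>\<close> holds the abscissae used on the line of slope
  \<kappa>.\<close>

definition cluster_sums :: "(real \<Rightarrow> real set) \<Rightarrow> real set \<Rightarrow> (real \<times> real) set"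
  where "cluster_sums X U = (\<lambda>((\<kappa>, \<mu>), (x, y)). (x + y, \<kappa> * x + \<mu> * y)) `
    Sigma {(\<kappa>, \<mu>). \<kappa> \<in> U \<and> \<mu> \<in> U \<and> \<kappa> < \<mu>} (\<lambda>(\<kappa>, \<mu>). X \<kappa> \<times> X \<mu>)"

text \<open>Pairs encode the triples: for nonzero \<gamma> the third variable is determined by the
  other two.\<close>

definition linear_triples :: "real set \<Rightarrow> real set \<Rightarrow> real set \<Rightarrow> real \<Rightarrow> real \<Rightarrow> real \<Rightarrow> (real \<times> real) set"
  where "linear_triples X Y Z \<alpha> \<beta> \<gamma> = {(x, y). x \<in> X \<and> y \<in> Y \<and> (\<exists>z\<in>Z. \<alpha> * x + \<beta> * y = \<gamma> * z)}"

lemma card_le_card_sumset: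
  fixes A B :: "real set"
  assumes "finite A" "finite B" "B \<noteq> {}"
  shows "card A \<le> card (A + B)"
proof -
  obtain b where "b \<in> B" using assms by blast
  then show ?thesis
    using assms finite_set_plus by (intro card_inj_on_le[of "\<lambda>a. a + b"]) (auto simp: inj_on_def)
qed

text \<open>Sums of positive vectors from two lines of a cluster lie strictly between its extreme
  lines, so different blocks of M consecutive slopes have disjoint sets of sums, all in (A + A) x (A
  + A). An incomplete last block is dropped, hence \<open>card S div M\<close>.\<close>

lemma cluster_partition:
  fixes A S :: "real set" and X :: "real \<Rightarrow> real set"
  assumes A: "finite A" and Apos: "\<And>a. a \<in> A \<Longrightarrow> a > 0" and S: "finite S" and M: "M \<ge> 1"
    and X: "\<And>\<kappa> x. \<kappa> \<in> S \<Longrightarrow> x \<in> X \<kappa> \<Longrightarrow> x \<in> A \<and> \<kappa> * x \<in> A"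
    and z: "\<And>U. U \<subseteq> S \<Longrightarrow> card U = M \<Longrightarrow> z \<le> c * card (cluster_sums X U)"
  shows "(card S div M) * z \<le> c * (card (A + A))\<^sup>2"
proof -
  define g where "g = card S div M"
  define U where "U i = {\<kappa>\<in>S. rank_in S \<kappa> div M = i}" for i
  have cardU: "card (U i) = M" if "i < g" for i
  proof -
    have "(i + 1) * M \<le> g * M" using that by (intro mult_le_mono1) auto
    also have "g * M \<le> card S" by (simp add: g_def)
    finally have "{k. k < card S \<and> k div M = i} = {i * M..<i * M + M}"
      using div_fibre[of M i] M by auto
    then show ?thesis using card_rank_in_div[OF S, of M i] M by (simp add: U_def)
  qed
  have finU: "finite (U i)" for i using S by (simp add: U_def)
  have less: "\<kappa> < \<mu>" if "\<kappa> \<in> U i" "\<mu> \<in> U j" "i < j" for \<kappa> \<mu> i j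
  proof (rule ccontr)
    assume "\<not> \<kappa> < \<mu>"
    then have "rank_in S \<mu> div M \<le> rank_in S \<kappa> div M"
      by (intro div_le_mono rank_in_mono S) auto
    then show False using that by (auto simp: U_def)
  qed
  have mem: "\<exists>\<kappa>\<in>U i. \<exists>\<mu>\<in>U i. \<kappa> * fst p < snd p \<and> snd p < \<mu> * fst p \<and> fst p > 0"
    if p: "p \<in> cluster_sums X (U i)" for p i
  proof -
    obtain \<kappa> \<mu> x y where *: "\<kappa> \<in> U i" "\<mu> \<in> U i" "\<kappa> < \<mu>" "x \<in> X \<kappa>" "y \<in> X \<mu>"
      "p = (x + y, \<kappa> * x + \<mu> * y)" using p by (auto simp: cluster_sums_def)
    then have "x > 0" "y > 0" using X Apos by (auto simp: U_def)
    then have "\<kappa> * y < \<mu> * y" "\<kappa> * x < \<mu> * x" using * by auto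
    with * \<open>x > 0\<close> \<open>y > 0\<close> show ?thesis
      by (intro bexI[of _ \<kappa>] bexI[of _ \<mu>]) (simp_all add: algebra_simps)
  qed
  have disj: "cluster_sums X (U i) \<inter> cluster_sums X (U j) = {}" if "i < j" for i j
  proof (rule ccontr)
    assume "cluster_sums X (U i) \<inter> cluster_sums X (U j) \<noteq> {}"
    then obtain p where p: "p \<in> cluster_sums X (U i)" "p \<in> cluster_sums X (U j)" by blast
    obtain \<mu> where \<mu>: "\<mu> \<in> U i" "snd p < \<mu> * fst p" "fst p > 0" using mem[OF p(1)] by blast
    obtain \<kappa> where \<kappa>: "\<kappa> \<in> U j" "\<kappa> * fst p < snd p" using mem[OF p(2)] by blast
    have "\<mu> * fst p < \<kappa> * fst p" using less[OF \<mu>(1) \<kappa>(1) that] \<mu>(3) by simp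
    then show False using \<mu> \<kappa> by linarith
  qed
  have sub: "cluster_sums X (U i) \<subseteq> (A + A) \<times> (A + A)" for i
  proof -
    have "x + y \<in> A + A \<and> \<kappa> * x + \<mu> * y \<in> A + A"
      if "\<kappa> \<in> U i" "\<mu> \<in> U i" "x \<in> X \<kappa>" "y \<in> X \<mu>" for \<kappa> \<mu> x y
      using X that by (auto simp: U_def intro!: set_plus_intro)
    then show ?thesis by (auto simp: cluster_sums_def)
  qed
  have finAA: "finite ((A + A) \<times> (A + A))" using A finite_set_plus by blast
  have "g * z = (\<Sum>i<g. z)" by simp
  also have "\<dots> \<le> (\<Sum>i<g. c * card (cluster_sums X (U i)))"
    using cardU by (intro sum_mono z) (auto simp: U_def)
  also have "\<dots> = c * card (\<Union>i<g. cluster_sums X (U i))"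
    using finite_subset[OF sub finAA] disj
    by (subst card_UN_disjoint) (auto simp: sum_distrib_left neq_iff)
  also have "\<dots> \<le> c * card ((A + A) \<times> (A + A))"
    using sub finAA by (intro mult_le_mono2 card_mono) auto
  finally show ?thesis by (simp add: g_def card_cartesian_product power2_eq_square)
qed

lemma card_less_pairs:
  fixes U :: "'a::linorder set"
  assumes "finite U"
  shows "2 * card {(x, y). x \<in> U \<and> y \<in> U \<and> x < y} + card U = (card U)\<^sup>2"
proof -
  let ?P = "{(x, y). x \<in> U \<and> y \<in> U \<and> x < y}" and ?D = "(\<lambda>x. (x, x)) ` U"
  have fin: "finite ?P" using assms by (rule_tac finite_subset[of _ "U \<times> U"]) auto
  have eq: "U \<times> U = (?P \<union> prod.swap ` ?P) \<union> ?D"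
    by (auto simp: image_iff neq_iff)
  have "?P \<inter> prod.swap ` ?P = {}" "(?P \<union> prod.swap ` ?P) \<inter> ?D = {}" by auto
  then have "card (U \<times> U) = card ?P + card (prod.swap ` ?P) + card ?D"
    unfolding eq using fin assms by (simp add: card_Un_disjoint)
  moreover have "card (prod.swap ` ?P) = card ?P" "card ?D = card U"
    by (auto intro!: card_image simp: inj_on_def)
  ultimately show ?thesis by (simp add: card_cartesian_product power2_eq_square)
qed

text \<open>One of \<open>\<kappa>'\<close>, \<open>\<mu>'\<close> is not in \<open>{\<kappa>, \<mu>}\<close>; eliminating its variable from the two equations leaves a
  linear relation between three variables with nonzero coefficients.\<close>

lemma card_collisions_le:
  assumes fin: "finite X" "finite Y" and ne: "\<kappa>' \<noteq> \<mu>'"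
    and c: "(\<mu>' \<noteq> \<kappa> \<and> \<mu>' \<noteq> \<mu>) \<or> (\<kappa>' \<noteq> \<kappa> \<and> \<kappa>' \<noteq> \<mu>)"
    and b1: "\<And>\<alpha> \<beta> \<gamma>. \<alpha> \<noteq> 0 \<Longrightarrow> \<beta> \<noteq> 0 \<Longrightarrow> \<gamma> \<noteq> 0 \<Longrightarrow> card (linear_triples X Y X' \<alpha> \<beta> \<gamma>) \<le> k"
    and b2: "\<And>\<alpha> \<beta> \<gamma>. \<alpha> \<noteq> 0 \<Longrightarrow> \<beta> \<noteq> 0 \<Longrightarrow> \<gamma> \<noteq> 0 \<Longrightarrow> card (linear_triples X Y Y' \<alpha> \<beta> \<gamma>) \<le> k"
  shows "card {((x, y), (x', y')). x \<in> X \<and> y \<in> Y \<and> x' \<in> X' \<and> y' \<in> Y' \<and>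
    x + y = x' + y' \<and> \<kappa> * x + \<mu> * y = \<kappa>' * x' + \<mu>' * y'} \<le> (k :: nat)" (is "card ?C \<le> k")
proof -
  \<comment> \<open>A vector has at most one decomposition along two distinct lines, so (x, y)
    determines the whole collision.\<close>
  have inj: "inj_on fst ?C"
  proof (rule inj_onI)
    fix p q assume p: "p \<in> ?C" and q: "q \<in> ?C" and eq: "fst p = fst q"
    obtain x y x' y' where p': "p = ((x, y), (x', y'))" by (metis surj_pair)
    obtain x'' y'' where q': "q = ((x, y), (x'', y''))" using eq p' by (metis surj_pair fst_conv)
    have e: "y' = x'' + y'' - x'" using p q by (simp add: p' q')
    have "\<kappa>' * x' + \<mu>' * y' = \<kappa>' * x'' + \<mu>' * y''" using p q by (simp add: p' q')
    then have "(\<kappa>' - \<mu>') * (x' - x'') = 0" unfolding e by (simp add: algebra_simps)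
    then show "p = q" using ne e by (simp add: p' q')
  qed
  have finT: "finite (linear_triples X Y Z \<alpha> \<beta> \<gamma>)" for Z \<alpha> \<beta> \<gamma>
    using fin by (rule_tac finite_subset[of _ "X \<times> Y"]) (auto simp: linear_triples_def)
  \<comment> \<open>Subtract \<nu> times the first equation from the second; \<nu> = \<mu>' or \<nu>
    = \<kappa>' then removes one variable of the second pair.\<close>
  have lin: "(\<kappa> - \<nu>) * x + (\<mu> - \<nu>) * y = (\<kappa>' - \<nu>) * x' + (\<mu>' - \<nu>) * y'"
    if "x + y = x' + y'" "\<kappa> * x + \<mu> * y = \<kappa>' * x' + \<mu>' * y'" for \<nu> x y x' y'
  proof -
    have "\<nu> * x + \<nu> * y = \<nu> * x' + \<nu> * y'" using that(1) by (metis distrib_left)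
    then show ?thesis using that(2) by (simp add: algebra_simps)
  qed
  from c show ?thesis
  proof
    assume c: "\<mu>' \<noteq> \<kappa> \<and> \<mu>' \<noteq> \<mu>"
    have "fst ` ?C \<subseteq> linear_triples X Y X' (\<kappa> - \<mu>') (\<mu> - \<mu>') (\<kappa>' - \<mu>')"
      using lin[of _ _ _ _ \<mu>'] by (fastforce simp: linear_triples_def)
    then have "card ?C \<le> card (linear_triples X Y X' (\<kappa> - \<mu>') (\<mu> - \<mu>') (\<kappa>' - \<mu>'))"
      using inj finT by (intro card_inj_on_le) auto
    also have "\<dots> \<le> k" using c ne by (intro b1) auto
    finally show ?thesis .
  next
    assume c: "\<kappa>' \<noteq> \<kappa> \<and> \<kappa>' \<noteq> \<mu>"
    have "fst ` ?C \<subseteq> linear_triples X Y Y' (\<kappa> - \<kappa>') (\<mu> - \<kappa>') (\<mu>' - \<kappa>')"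
      using lin[of _ _ _ _ \<kappa>'] by (fastforce simp: linear_triples_def)
    then have "card ?C \<le> card (linear_triples X Y Y' (\<kappa> - \<kappa>') (\<mu> - \<kappa>') (\<mu>' - \<kappa>'))"
      using inj finT by (intro card_inj_on_le) auto
    also have "\<dots> \<le> k" using c ne by (intro b2) auto
    finally show ?thesis .
  qed
qed

text \<open>Count collisions over the J pairs of lines. Equal pairs of lines contribute at most |I|
  in total; different ones at most 4 \<tau>^2 / M^2 each, hence at most 2 |I| because 2 J <= M^2. So
  the image has at least |I| / 3 elements, where |I| = J \<tau>^2 >= M^2 \<tau>^2 / 4.\<close>

lemma card_cluster_sums:
  fixes U :: "real set" and X :: "real \<Rightarrow> real set"
  assumes U: "finite U" "card U = M" "M \<ge> 2"
    and X: "\<And>\<kappa>. \<kappa> \<in> U \<Longrightarrow> finite (X \<kappa>) \<and> card (X \<kappa>) = \<tau>"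
    and few: "\<And>\<kappa> \<mu> \<nu> \<alpha> \<beta> \<gamma>. \<kappa> \<in> U \<Longrightarrow> \<mu> \<in> U \<Longrightarrow> \<nu> \<in> U \<Longrightarrow> \<alpha> \<noteq> 0 \<Longrightarrow> \<beta> \<noteq> 0 \<Longrightarrow> \<gamma> \<noteq> 0 \<Longrightarrow>
      M\<^sup>2 * card (linear_triples (X \<kappa>) (X \<mu>) (X \<nu>) \<alpha> \<beta> \<gamma>) \<le> 4 * \<tau>\<^sup>2"
  shows "M\<^sup>2 * \<tau>\<^sup>2 \<le> 12 * card (cluster_sums X U)"
proof -
  define P where "P = {(\<kappa>, \<mu>). \<kappa> \<in> U \<and> \<mu> \<in> U \<and> \<kappa> < \<mu>}"
  define XX where "XX = (\<lambda>(\<kappa>, \<mu>). X \<kappa> \<times> X \<mu>)"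
  define f where "f = (\<lambda>((\<kappa>::real, \<mu>::real), (x::real, y::real)). (x + y, \<kappa> * x + \<mu> * y))"
  define I where "I = Sigma P XX"
  define J where "J = card P"
  have finP: "finite P" using U by (rule_tac finite_subset[of _ "U \<times> U"]) (auto simp: P_def)
  have XX: "finite (XX p)" "card (XX p) = \<tau>\<^sup>2" if "p \<in> P" for p
    using X that by (auto simp: P_def XX_def card_cartesian_product power2_eq_square)
  have finI: "finite I" using finP XX by (auto simp: I_def)
  have cardI: "card I = J * \<tau>\<^sup>2" using finP XX by (simp add: I_def J_def card_SigmaI)
  have J: "2 * J + M = M\<^sup>2" using card_less_pairs[OF U(1)] U(2) by (simp add: J_def P_def)
  define C where "C p q = {(a, b). a \<in> XX p \<and> b \<in> XX q \<and> f (q, b) = f (p, a)}" for p q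
  have finC: "finite (C p q)" if "p \<in> P" "q \<in> P" for p q
    using XX that by (rule_tac finite_subset[of _ "XX p \<times> XX q"]) (auto simp: C_def)
  have diag: "card (C p p) \<le> \<tau>\<^sup>2" if pP: "p \<in> P" for p
  proof -
    obtain \<kappa> \<mu> where p: "p = (\<kappa>, \<mu>)" "\<kappa> < \<mu>" using pP by (auto simp: P_def)
    have "a = b" if "f (p, b) = f (p, a)" for a b
    proof -
      obtain x y x' y' where ab: "a = (x, y)" "b = (x', y')" by fastforce
      have e: "x' = x + y - y'" "\<kappa> * x' + \<mu> * y' = \<kappa> * x + \<mu> * y"
        using that by (auto simp: f_def p ab)
      have "(\<mu> - \<kappa>) * (y' - y) = 0" using e(2) unfolding e(1) by (simp add: algebra_simps)
      then show ?thesis using p e ab by auto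
    qed
    then have "card (C p p) \<le> card (XX p)"
      using XX[OF pP] by (intro card_inj_on_le[of fst]) (auto simp: C_def inj_on_def)
    then show ?thesis using XX[OF pP] by simp
  qed
  \<comment> \<open>Both pairs are increasing, so if they differ, some slope of \<open>q\<close>
    does not occur in \<open>p\<close>, as \<open>card_collisions_le\<close> demands.\<close>
  have off: "M\<^sup>2 * card (C p q) \<le> 4 * \<tau>\<^sup>2" if pq: "p \<in> P" "q \<in> P" "p \<noteq> q" for p q
  proof -
    obtain \<kappa> \<mu> where p: "p = (\<kappa>, \<mu>)" "\<kappa> < \<mu>" "\<kappa> \<in> U" "\<mu> \<in> U" using pq by (auto simp: P_def)
    obtain \<kappa>' \<mu>' where q: "q = (\<kappa>', \<mu>')" "\<kappa>' < \<mu>'" "\<kappa>' \<in> U" "\<mu>' \<in> U" using pq by (auto simp: P_def)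
    have M2: "M\<^sup>2 > 0" using U by simp
    have le: "card (linear_triples (X \<kappa>) (X \<mu>) (X \<nu>) \<alpha> \<beta> \<gamma>) \<le> 4 * \<tau>\<^sup>2 div M\<^sup>2"
      if "\<nu> \<in> U" "\<alpha> \<noteq> 0" "\<beta> \<noteq> 0" "\<gamma> \<noteq> 0" for \<nu> \<alpha> \<beta> \<gamma>
      using few[OF p(3,4) that] M2 by (simp add: less_eq_div_iff_mult_less_eq mult.commute)
    have eq: "C p q = {((x, y), (x', y')). x \<in> X \<kappa> \<and> y \<in> X \<mu> \<and> x' \<in> X \<kappa>' \<and> y' \<in> X \<mu>' \<and>
        x + y = x' + y' \<and> \<kappa> * x + \<mu> * y = \<kappa>' * x' + \<mu>' * y'}"
      by (auto simp: C_def XX_def f_def p q)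
    have "card (C p q) \<le> 4 * \<tau>\<^sup>2 div M\<^sup>2"
      unfolding eq using pq p q X le by (intro card_collisions_le) auto
    then show ?thesis using M2 by (simp add: less_eq_div_iff_mult_less_eq mult.commute)
  qed
  define K where "K = {(i, j). i \<in> I \<and> j \<in> I \<and> f j = f i}"
  have "card K \<le> card (Sigma (P \<times> P) (\<lambda>(p, q). C p q))"
    using finP finC by (intro card_inj_on_le[of "\<lambda>((p, a), (q, b)). ((p, q), (a, b))"])
      (auto simp: K_def I_def C_def inj_on_def)
  also have "\<dots> = (\<Sum>p\<in>P. \<Sum>q\<in>P. card (C p q))"
    using finP finC by (subst card_SigmaI) (auto simp: sum.cartesian_product case_prod_beta)
  finally have "M\<^sup>2 * card K \<le> (\<Sum>p\<in>P. \<Sum>q\<in>P. M\<^sup>2 * card (C p q))"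
    by (simp flip: sum_distrib_left)
  also have "\<dots> \<le> (\<Sum>p\<in>P. \<Sum>q\<in>P. (if q = p then M\<^sup>2 * \<tau>\<^sup>2 else 0) + 4 * \<tau>\<^sup>2)"
  proof (intro sum_mono)
    fix p q assume pq: "p \<in> P" "q \<in> P"
    show "M\<^sup>2 * card (C p q) \<le> (if q = p then M\<^sup>2 * \<tau>\<^sup>2 else 0) + 4 * \<tau>\<^sup>2"
      using diag[OF pq(1)] off[OF pq] by (cases "q = p") (auto intro: trans_le_add1 mult_le_mono2)
  qed
  also have "\<dots> = J * (M\<^sup>2 * \<tau>\<^sup>2) + J * J * (4 * \<tau>\<^sup>2)"
    using finP by (simp add: sum.distrib J_def distrib_left)
  also have "J * J * (4 * \<tau>\<^sup>2) \<le> J * (2 * (M\<^sup>2 * \<tau>\<^sup>2))"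
  proof -
    have "2 * J \<le> M\<^sup>2" using J by simp
    then have "2 * J * (J * (2 * \<tau>\<^sup>2)) \<le> M\<^sup>2 * (J * (2 * \<tau>\<^sup>2))" by (rule mult_le_mono1)
    then show ?thesis by (simp add: mult_ac)
  qed
  finally have "M\<^sup>2 * card K \<le> M\<^sup>2 * (3 * card I)"
    by (simp add: cardI algebra_simps)
  then have K: "card K \<le> 3 * card I" using U by simp
  have img: "f ` I = cluster_sums X U"
    by (simp add: f_def I_def cluster_sums_def P_def XX_def)
  have "(card I)\<^sup>2 \<le> card (f ` I) * card K"
    unfolding K_def by (rule card_cauchy_schwarz[OF finI])
  also have "\<dots> \<le> card (f ` I) * (3 * card I)" using K by (rule mult_le_mono2)
  finally have "card I * card I \<le> (3 * card (f ` I)) * card I"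
    by (simp add: power2_eq_square mult_ac)
  then have "card I \<le> 3 * card (f ` I)" by (cases "card I = 0") auto
  moreover have "M\<^sup>2 * \<tau>\<^sup>2 \<le> 4 * card I"
  proof -
    have "2 * M \<le> M\<^sup>2" using U by (simp add: power2_eq_square)
    then have "M\<^sup>2 \<le> 4 * J" using J by linarith
    then have "M\<^sup>2 * \<tau>\<^sup>2 \<le> 4 * J * \<tau>\<^sup>2" by (rule mult_le_mono1)
    then show ?thesis by (simp add: cardI)
  qed
  ultimately show ?thesis unfolding img by linarith
qed

text \<open>Solymosi's bound is the case M = 2, where the condition on linear triples only says that
  there are at most t^2 of them. Clusters need |S| >= 2; otherwise t <= |A| <= |A + A|
  suffices.\<close>

lemma solymosi_rich_slopes:
  fixes A S :: "real set"
  assumes A: "finite A" and Apos: "\<And>a. a \<in> A \<Longrightarrow> a > 0" and S: "finite S"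
    and t: "\<And>\<kappa>. \<kappa> \<in> S \<Longrightarrow> t \<le> card {x\<in>A. \<kappa> * x \<in> A}"
  shows "card S * t\<^sup>2 \<le> 9 * (card (A + A))\<^sup>2"
proof (cases "card S \<le> 1")
  case True
  have "card S * t\<^sup>2 \<le> (card (A + A))\<^sup>2"
  proof (cases "S = {}")
    case False
    then obtain \<kappa> where "\<kappa> \<in> S" by blast
    then have "t \<le> card {x\<in>A. \<kappa> * x \<in> A}" by (rule t)
    also have "\<dots> \<le> card A" using A by (intro card_mono) auto
    also have "\<dots> \<le> card (A + A)"
      using card_le_card_sumset[OF A A] by (cases "A = {}") auto
    finally have "t\<^sup>2 \<le> (card (A + A))\<^sup>2" by (rule power_mono) simp
    then show ?thesis using mult_le_mono[OF True] by simp
  qed auto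
  then show ?thesis by simp
next
  case False
  have "\<exists>Y. Y \<subseteq> {x\<in>A. \<kappa> * x \<in> A} \<and> card Y = t" if "\<kappa> \<in> S" for \<kappa>
    using obtain_subset_with_card_n[OF t[OF that]] by metis
  then obtain X where X: "\<And>\<kappa>. \<kappa> \<in> S \<Longrightarrow> X \<kappa> \<subseteq> {x\<in>A. \<kappa> * x \<in> A} \<and> card (X \<kappa>) = t"
    by metis
  have finX: "finite (X \<kappa>)" if "\<kappa> \<in> S" for \<kappa>
    using X[OF that] A by (auto intro: finite_subset)
  have half: "(card S div 2) * (2\<^sup>2 * t\<^sup>2) \<le> 12 * (card (A + A))\<^sup>2"
  proof (rule cluster_partition[OF A Apos S])
    fix U assume U: "U \<subseteq> S" "card U = 2"
    show "2\<^sup>2 * t\<^sup>2 \<le> 12 * card (cluster_sums X U)"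
    proof (rule card_cluster_sums)
      show "finite U" using U(2) by (metis card.infinite zero_neq_numeral)
      fix \<kappa> \<mu> \<nu> \<alpha> \<beta> \<gamma> :: real assume *: "\<kappa> \<in> U" "\<mu> \<in> U"
      then have "card (linear_triples (X \<kappa>) (X \<mu>) (X \<nu>) \<alpha> \<beta> \<gamma>) \<le> card (X \<kappa> \<times> X \<mu>)"
        using U finX by (intro card_mono) (auto simp: linear_triples_def)
      then show "2\<^sup>2 * card (linear_triples (X \<kappa>) (X \<mu>) (X \<nu>) \<alpha> \<beta> \<gamma>) \<le> 4 * t\<^sup>2"
        using X * U by (simp add: card_cartesian_product power2_eq_square subset_iff)
    qed (use U X finX in auto)
  qed (use X in auto)
  have "card S * t\<^sup>2 \<le> (3 * (card S div 2)) * t\<^sup>2"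
    using False by (intro mult_le_mono1) presburger
  then have "card S * t\<^sup>2 \<le> 3 * ((card S div 2) * t\<^sup>2)" by simp
  moreover have "4 * ((card S div 2) * t\<^sup>2) \<le> 12 * (card (A + A))\<^sup>2" using half by simp
  ultimately show ?thesis by linarith
qed

section \<open>Sumsets of sets with many quotient representations\<close>

definition reps :: "real set \<Rightarrow> real set \<Rightarrow> real \<Rightarrow> nat"
  where "reps B C x = card {c\<in>C. x - c \<in> B}"

lemma reps_le_right: "finite C \<Longrightarrow> reps B C x \<le> card C"
  unfolding reps_def by (rule card_mono) auto

lemma reps_le_left: "finite B \<Longrightarrow> reps B C x \<le> card B"
  unfolding reps_def by (rule card_inj_on_le[of "\<lambda>c. x - c"]) (auto simp: inj_on_def)

text \<open>If \<open>x = a + c\<close> and \<open>a = p / u\<close>, then \<open>(1 / u, x)\<close> lies on the line with slope \<open>p\<close> and intercept \<open>c\<close>.\<close>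

lemma rich_sums:
  fixes B C R P X :: "real set"
  assumes fin: "finite B" "finite C" "finite R" "finite P" "finite X"
    and pos: "\<And>u. u \<in> R \<Longrightarrow> u > 0" "\<And>p. p \<in> P \<Longrightarrow> p > 0"
    and BP: "card B \<le> card P"
    and T: "\<And>a. a \<in> B \<Longrightarrow> T \<le> card {u\<in>R. a * u \<in> P}"
    and t: "t \<ge> 1" and X: "\<And>x. x \<in> X \<Longrightarrow> t \<le> reps B C x"
  shows "card X * (T * t) ^ 3 \<le> 2048 * ((card R)\<^sup>2 * (card P)\<^sup>2 * (card C)\<^sup>2)"
proof (cases "X = {}")
  case True then show ?thesis by simp
next
  case False
  then obtain x0 where x0: "x0 \<in> X" by blast
  have "reps B C x0 > 0" using X[OF x0] t by simp
  then obtain c0 where "c0 \<in> C" "x0 - c0 \<in> B" by (auto simp: reps_def card_gt_0_iff)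
  then have "T \<le> card {u\<in>R. (x0 - c0) * u \<in> P}" by (intro T)
  also have "\<dots> \<le> card R" using fin by (intro card_mono) auto
  finally have TR: "T \<le> card R" .
  have tB: "t \<le> card P" using X[OF x0] reps_le_left[OF fin(1), of C x0] BP by linarith
  have tC: "t \<le> card C" using X[OF x0] reps_le_right[OF fin(2), of B x0] by linarith
  \<comment> \<open>The grid is V x X and the lines are indexed by P x C; each (x, c, u) with x - c
    in \<open>B\<close> and (x - c) u in \<open>P\<close> is an incidence.\<close>
  define V where "V = inverse ` R"
  have finV: "finite V" and cardV: "card V \<le> card R"
    using fin by (auto simp: V_def card_image_le)
  define i where "i l = card (line_pts V X l)" for l
  define q where "q = card P * card C"
  define J where "J = card X * (t * T)"
  have q: "q > 0" using tB tC t by (simp add: q_def)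
  have inc: "J \<le> (\<Sum>l\<in>P \<times> C. i l)"
  proof -
    define Q where "Q = Sigma X (\<lambda>x. Sigma {c\<in>C. x - c \<in> B} (\<lambda>c. {u\<in>R. (x - c) * u \<in> P}))"
    have "J = (\<Sum>x\<in>X. t * T)" by (simp add: J_def)
    also have "\<dots> \<le> (\<Sum>x\<in>X. \<Sum>c\<in>{c\<in>C. x - c \<in> B}. card {u\<in>R. (x - c) * u \<in> P})"
    proof (rule sum_mono)
      fix x assume "x \<in> X"
      then have "t * T \<le> card {c\<in>C. x - c \<in> B} * T"
        using X by (intro mult_le_mono1) (auto simp: reps_def)
      also have "\<dots> = (\<Sum>c\<in>{c\<in>C. x - c \<in> B}. T)" by simp
      also have "\<dots> \<le> (\<Sum>c\<in>{c\<in>C. x - c \<in> B}. card {u\<in>R. (x - c) * u \<in> P})"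
        by (intro sum_mono T) auto
      finally show "t * T \<le> (\<Sum>c\<in>{c\<in>C. x - c \<in> B}. card {u\<in>R. (x - c) * u \<in> P})" .
    qed
    also have "\<dots> = card Q" using fin by (simp add: Q_def)
    also have "\<dots> \<le> card (Sigma (P \<times> C) (line_pts V X))"
    proof (rule card_inj_on_le[of "\<lambda>(x, c, u). (((x - c) * u, c), inverse u)"])
      show "inj_on (\<lambda>(x, c, u). (((x - c) * u, c), inverse u)) Q"
      proof (rule inj_onI)
        fix p p' assume p: "p \<in> Q" "p' \<in> Q"
          and e: "(\<lambda>(x, c, u). (((x - c) * u, c), inverse u)) p = (\<lambda>(x, c, u). (((x - c) * u, c), inverse u)) p'"
        obtain x c u where 1: "p = (x, c, u)" by (metis surj_pair)
        obtain x' c' u' where 2: "p' = (x', c', u')" by (metis surj_pair)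
        have "u > 0" using p pos by (auto simp: Q_def 1)
        then show "p = p'" using e by (auto simp: 1 2)
      qed
      show "(\<lambda>(x, c, u). (((x - c) * u, c), inverse u)) ` Q \<subseteq> Sigma (P \<times> C) (line_pts V X)"
      proof (rule image_subsetI)
        fix p assume p: "p \<in> Q"
        obtain x c u where 1: "p = (x, c, u)" by (metis surj_pair)
        have "u > 0" using p pos by (auto simp: Q_def 1)
        then have "(x - c) * u * inverse u + c = x" by (simp add: field_simps)
        then show "(\<lambda>(x, c, u). (((x - c) * u, c), inverse u)) p \<in> Sigma (P \<times> C) (line_pts V X)"
          using p by (auto simp: Q_def 1 line_pts_def V_def)
      qed
      show "finite (Sigma (P \<times> C) (line_pts V X))" using fin finV by auto
    qed
    also have "\<dots> = (\<Sum>l\<in>P \<times> C. i l)" using fin finV by (simp add: i_def)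
    finally show ?thesis .
  qed
  \<comment> \<open>Lines with fewer than \<open>4 * s\<close> points contribute at most half of
    \<open>J\<close>, a lower bound for the number of incidences. For \<open>s = 0\<close> the
    trivial bounds on \<open>T\<close> and \<open>t\<close> suffice.\<close>
  define s where "s = J div (8 * q)"
  have "J * (T * t)\<^sup>2 \<le> 2048 * ((card R)\<^sup>2 * (card P)\<^sup>2 * (card C)\<^sup>2)"
  proof (cases "s = 0")
    case True
    then have "J \<le> 8 * q" using q by (simp add: s_def div_eq_0_iff)
    moreover have "T\<^sup>2 * t\<^sup>2 \<le> (card R)\<^sup>2 * q"
      unfolding q_def power2_eq_square by (intro mult_le_mono TR tB tC)
    then have "(T * t)\<^sup>2 \<le> (card R)\<^sup>2 * q" by (simp only: power_mult_distrib)
    ultimately have "J * (T * t)\<^sup>2 \<le> 8 * q * ((card R)\<^sup>2 * q)" by (rule mult_le_mono)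
    also have "\<dots> = 8 * ((card R)\<^sup>2 * (card P)\<^sup>2 * (card C)\<^sup>2)"
      by (simp add: q_def power2_eq_square mult_ac)
    finally show ?thesis by simp
  next
    case False
    then have s: "s \<ge> 1" by simp
    have J1: "8 * (s * q) \<le> J"
      using div_times_less_eq_dividend[of J "8 * q"] by (simp add: s_def mult_ac)
    have J2: "J \<le> 16 * (s * q)"
    proof -
      have "J < s * (8 * q) + 8 * q"
        using dividend_less_div_times[of "8 * q" J] q by (simp add: s_def)
      moreover have "8 * q \<le> s * (8 * q)" using s by simp
      ultimately have "J \<le> 2 * (s * (8 * q))" by linarith
      then show ?thesis by (simp add: mult_ac)
    qed
    define L where "L = {l\<in>P \<times> C. 4 * s \<le> i l}"
    have "J \<le> (\<Sum>l\<in>L. i l) + (\<Sum>l\<in>P \<times> C - L. i l)"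
      using inc fin by (subst (asm) sum.subset_diff[of L]) (auto simp: L_def)
    also have "(\<Sum>l\<in>P \<times> C - L. i l) \<le> (\<Sum>l\<in>P \<times> C - L. 4 * s)"
      by (intro sum_mono) (auto simp: L_def)
    also have "\<dots> \<le> (\<Sum>l\<in>P \<times> C. 4 * s)" using fin by (intro sum_mono2) auto
    also have "\<dots> = 4 * (s * q)" by (simp add: q_def card_cartesian_product)
    finally have half: "J \<le> 2 * (\<Sum>l\<in>L. i l)" using J1 by linarith
    have "4 * s * (\<Sum>l\<in>L. i l) \<le> (\<Sum>l\<in>L. (i l)\<^sup>2)"
      unfolding sum_distrib_left by (intro sum_mono) (auto simp: L_def power2_eq_square)
    then have "s * (4 * s * (\<Sum>l\<in>L. i l)) \<le> s * (\<Sum>l\<in>L. (i l)\<^sup>2)" by (rule mult_le_mono2)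
    also have "\<dots> \<le> 16 * (card V)\<^sup>2 * (card X)\<^sup>2"
      unfolding i_def using pos fin by (intro rich_lines finV s) (auto simp: L_def i_def)
    also have "\<dots> \<le> 16 * (card R)\<^sup>2 * (card X)\<^sup>2"
      using cardV by (intro mult_le_mono power_mono) auto
    finally have 1: "s * (4 * s * (\<Sum>l\<in>L. i l)) \<le> 16 * (card R)\<^sup>2 * (card X)\<^sup>2" .
    have "s * s * J \<le> s * s * (2 * (\<Sum>l\<in>L. i l))" using half by (rule mult_le_mono2)
    moreover have "s * s * (2 * (\<Sum>l\<in>L. i l)) = 2 * (s * (s * (\<Sum>l\<in>L. i l)))"
      by (simp only: mult_ac)
    moreover have "s * (s * (\<Sum>l\<in>L. i l)) \<le> 4 * ((card R)\<^sup>2 * (card X)\<^sup>2)"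
      using 1 by (simp add: mult_ac)
    ultimately have sJ: "s * s * J \<le> 8 * ((card R)\<^sup>2 * (card X)\<^sup>2)" by linarith
    have "J * J * J \<le> (16 * (s * q)) * (16 * (s * q)) * J"
      using J2 by (intro mult_le_mono) auto
    also have "\<dots> = 256 * (q * q) * (s * s * J)" by (simp add: mult_ac)
    also have "\<dots> \<le> 256 * (q * q) * (8 * ((card R)\<^sup>2 * (card X)\<^sup>2))"
      using sJ by (rule mult_le_mono2)
    finally have "(card X)\<^sup>2 * (J * (T * t)\<^sup>2) \<le> (card X)\<^sup>2 * (2048 * ((card R)\<^sup>2 * (card P)\<^sup>2 * (card C)\<^sup>2))"
      by (simp add: J_def q_def power2_eq_square mult_ac)
    moreover have "0 < card X" using x0 fin by (auto simp: card_gt_0_iff)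
    ultimately show ?thesis by simp
  qed
  moreover have "J * (T * t)\<^sup>2 = card X * (T * t) ^ 3"
    by (simp add: J_def power3_eq_cube power2_eq_square mult_ac)
  ultimately show ?thesis by simp
qed

text \<open>Take the sixth power of \<open>a1\<close>, the square of \<open>a2\<close> and
  \<open>a3\<close> once: m and F drop out, and b^24 is at most b^5 times the right-hand
  side.\<close>

lemma energy_chain:
  fixes b s m D H F Delta d :: real
  assumes nn: "b > 0" "s \<ge> 0" "m \<ge> 0" "D \<ge> 0" "H \<ge> 0" "F \<ge> 0"
    and a1: "b ^ 4 \<le> s * (2 * H * m)"
    and a2: "m ^ 3 \<le> 3 * H * D * F * (D * b\<^sup>2)"
    and a3: "F\<^sup>2 \<le> 4 * H\<^sup>2 * (D * b * s ^ 3)"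
  shows "b ^ 19 \<le> 2304 * H ^ 10 * D ^ 5 * s ^ 9"
proof -
  have "m ^ 6 = (m ^ 3)\<^sup>2" by (simp flip: power_mult)
  also have "\<dots> \<le> (3 * H * D * F * (D * b\<^sup>2))\<^sup>2"
    using nn by (intro power_mono a2) auto
  also have "\<dots> = 9 * H\<^sup>2 * D ^ 4 * b ^ 4 * F\<^sup>2"
    by (simp add: power_mult_distrib power2_eq_square power4_eq_xxxx mult_ac)
  also have "\<dots> \<le> 9 * H\<^sup>2 * D ^ 4 * b ^ 4 * (4 * H\<^sup>2 * (D * b * s ^ 3))"
    using nn by (intro mult_left_mono a3) auto
  finally have m6: "m ^ 6 \<le> 9 * H\<^sup>2 * D ^ 4 * b ^ 4 * (4 * H\<^sup>2 * (D * b * s ^ 3))" .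
  have "b ^ 24 = (b ^ 4) ^ 6" by (simp flip: power_mult)
  also have "\<dots> \<le> (s * (2 * H * m)) ^ 6" using nn by (intro power_mono a1) auto
  also have "\<dots> = 64 * s ^ 6 * H ^ 6 * m ^ 6" by (simp add: power_mult_distrib)
  also have "\<dots> \<le> 64 * s ^ 6 * H ^ 6 * (9 * H\<^sup>2 * D ^ 4 * b ^ 4 * (4 * H\<^sup>2 * (D * b * s ^ 3)))"
    using nn by (intro mult_left_mono m6) auto
  also have "\<dots> = b ^ 5 * (2304 * H ^ 10 * D ^ 5 * s ^ 9)"
    by (simp add: eval_nat_numeral(2,3) algebra_simps)
  finally have "b ^ 5 * b ^ 19 \<le> b ^ 5 * (2304 * H ^ 10 * D ^ 5 * s ^ 9)"
    by (simp only: power_add[symmetric]) simp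
  then show ?thesis using nn by (metis mult_le_cancel_left_pos zero_less_power)
qed

text \<open>The first-moment (Markov) bound at the chosen level is kept as well: it limits the
  number of popular slopes and allows interpolation between first and third moments.\<close>

lemma level_set_sums:
  fixes f :: "'a \<Rightarrow> nat"
  assumes "finite I" "N \<ge> 1" "\<And>i. i \<in> I \<Longrightarrow> f i \<le> N"
  obtains t where "1 \<le> t" "t \<le> N" "t * card {i\<in>I. t \<le> f i} \<le> sum f I"
    "(\<Sum>i\<in>I. real (f i) ^ 2) \<le> 2 * harm N * (real t ^ 2 * real (card {i\<in>I. t \<le> f i}))"
proof -
  obtain t where t: "1 \<le> t" "t \<le> N"
    "(\<Sum>i\<in>I. real (f i) ^ 2) \<le> real 2 * harm N * (real t ^ 2 * real (card {i\<in>I. t \<le> f i}))"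
    by (rule level_set[of I N f 2]) (use assms in auto)
  have "t * card {i\<in>I. t \<le> f i} = (\<Sum>i\<in>{i\<in>I. t \<le> f i}. t)" by simp
  also have "\<dots> \<le> (\<Sum>i\<in>{i\<in>I. t \<le> f i}. f i)" by (intro sum_mono) auto
  also have "\<dots> \<le> sum f I" using assms by (intro sum_mono2) auto
  finally show thesis using that t by auto
qed

text \<open>Schoen and Shkredov's argument: writing \<open>x - y = (x + z) - (y + z)\<close>, every popular
  difference of \<open>B\<close> is a difference of two elements of \<open>B + B\<close> in many ways, and the number of
  such coincidences is controlled by the third-moment hypothesis \<open>st\<close>.\<close>

lemma sumset_lower_bound:
  fixes B :: "real set" and D :: real
  assumes B: "finite B" "B \<noteq> {}" and D: "D \<ge> 0"
    and st: "\<And>C X t. finite C \<Longrightarrow> finite X \<Longrightarrow> t \<ge> 1 \<Longrightarrow> (\<And>x. x \<in> X \<Longrightarrow> t \<le> reps B C x) \<Longrightarrow>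
      real (card X) * real t ^ 3 \<le> D * (real (card C))\<^sup>2"
  shows "real (card B) ^ 19 \<le> 2304 * harm (card B) ^ 10 * D ^ 5 * real (card (B + B)) ^ 9"
proof -
  define b where "b = card B"
  have b: "b \<ge> 1" using B by (simp add: b_def Suc_le_eq card_gt_0_iff)
  define Q where "Q = B + B"
  define s where "s = card Q"
  define H :: real where "H = harm b"
  have H: "H \<ge> 0" by (simp add: H_def harm_nonneg)
  have finQ: "finite Q" unfolding Q_def using B by (intro finite_set_plus)
  have QI: "x + y \<in> Q" if "x \<in> B" "y \<in> B" for x y
    using that by (auto simp: Q_def intro: set_plus_intro)
  define R where "R d = {(x, z). x \<in> B \<and> z \<in> B \<and> x - z = d}" for d
  define r where "r d = card (R d)" for d
  define DD where "DD = (\<lambda>(x, z). x - z) ` (B \<times> B)"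
  have finR: "finite (R d)" for d
    using B by (rule_tac finite_subset[of _ "B \<times> B"]) (auto simp: R_def)
  have finDD: "finite DD" using B by (simp add: DD_def)
  have DDI: "x - z \<in> DD" if "x \<in> B" "z \<in> B" for x z using that by (force simp: DD_def)
  have r_reps: "r d = reps B (uminus ` B) d" for d
    unfolding r_def reps_def
    by (rule bij_betw_same_card[of "\<lambda>(x, z). - z"], rule bij_betwI[where g = "\<lambda>c. (d - c, - c)"])
      (auto simp: R_def image_iff intro: bexI[where x = "- _"])
  have r_le: "r d \<le> b" for d using r_reps reps_le_left[OF B(1)] by (simp add: b_def)
  have cardneg: "card (uminus ` B) = b" by (simp add: b_def card_image)

  \<comment> \<open>x + y = x' + y' is the same as x - x' = y' - y, so collisions of addition are
    counted by the squares of \<open>r\<close>.\<close>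
  have energy: "real b ^ 4 \<le> real s * (\<Sum>d\<in>DD. real (r d) ^ 2)"
  proof -
    define f where "f = (\<lambda>(x::real, y::real). x + y)"
    define K where "K = {(p, q). p \<in> B \<times> B \<and> q \<in> B \<times> B \<and> f q = f p}"
    have "card K \<le> card (Sigma DD (\<lambda>d. R d \<times> R d))"
      using finDD finR by (intro card_inj_on_le[of "\<lambda>((x, y), (x', y')). (x - x', (x, x'), (y', y))"])
        (auto simp: K_def f_def R_def inj_on_def DDI)
    also have "\<dots> = (\<Sum>d\<in>DD. (r d)\<^sup>2)"
      using finDD finR by (simp add: r_def card_cartesian_product power2_eq_square)
    finally have K: "card K \<le> (\<Sum>d\<in>DD. (r d)\<^sup>2)" .
    have "f ` (B \<times> B) \<subseteq> Q" using QI by (auto simp: f_def)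
    then have "card (f ` (B \<times> B)) \<le> s" using finQ by (simp add: s_def card_mono)
    then have "card (f ` (B \<times> B)) * card K \<le> s * (\<Sum>d\<in>DD. (r d)\<^sup>2)" using K by (rule mult_le_mono)
    moreover have "(card (B \<times> B))\<^sup>2 \<le> card (f ` (B \<times> B)) * card K"
      unfolding K_def using B by (intro card_cauchy_schwarz) auto
    ultimately have "(card (B \<times> B))\<^sup>2 \<le> s * (\<Sum>d\<in>DD. (r d)\<^sup>2)" by linarith
    then have "b ^ 4 \<le> s * (\<Sum>d\<in>DD. (r d)\<^sup>2)"
      by (simp add: card_cartesian_product b_def power2_eq_square power4_eq_xxxx mult_ac)
    then have "real (b ^ 4) \<le> real (s * (\<Sum>d\<in>DD. (r d)\<^sup>2))" by (rule of_nat_mono)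
    then show ?thesis by simp
  qed

  from level_set_sums[of DD b r, OF finDD b r_le] obtain \<Delta> where \<Delta>: "1 \<le> \<Delta>" "\<Delta> \<le> b"
    "(\<Sum>d\<in>DD. real (r d) ^ 2) \<le> 2 * harm b * (real \<Delta> ^ 2 * real (card {d\<in>DD. \<Delta> \<le> r d}))"
    by blast
  define E where "E = {d\<in>DD. \<Delta> \<le> r d}"
  have finE: "finite E" using finDD by (simp add: E_def)
  define e where "e = card E"
  have st_r: "real (card X) * real t ^ 3 \<le> D * (real b)\<^sup>2"
    if "finite X" "t \<ge> 1" "\<And>x. x \<in> X \<Longrightarrow> t \<le> r x" for X t
    using st[of "uminus ` B" X t] that B cardneg r_reps by simp
  have eD: "real e * real \<Delta> ^ 3 \<le> D * (real b)\<^sup>2"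
    unfolding e_def by (rule st_r[OF finE \<Delta>(1)]) (simp add: E_def)

  have cubes: "(\<Sum>d\<in>DD. real (r d) ^ 3) \<le> 3 * H * (D * (real b)\<^sup>2)"
  proof -
    have "(1::nat) \<le> 3" by simp
    from level_set[of DD b r 3, OF finDD b r_le this] obtain t where t: "1 \<le> t" "t \<le> b"
      "(\<Sum>d\<in>DD. real (r d) ^ 3) \<le> real 3 * harm b * (real t ^ 3 * real (card {d\<in>DD. t \<le> r d}))"
      by blast
    have "real (card {d\<in>DD. t \<le> r d}) * real t ^ 3 \<le> D * (real b)\<^sup>2"
      by (rule st_r) (use t(1) finDD in auto)
    then have "real t ^ 3 * real (card {d\<in>DD. t \<le> r d}) \<le> D * (real b)\<^sup>2"
      by (simp only: mult.commute)
    then have "3 * H * (real t ^ 3 * real (card {d\<in>DD. t \<le> r d})) \<le> 3 * H * (D * (real b)\<^sup>2)"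
      using H by (intro mult_left_mono) simp_all
    with t(3) show ?thesis by (simp only: H_def of_nat_numeral)
  qed

  define V where "V = {(u, v). u \<in> Q \<and> v \<in> Q \<and> u - v \<in> E}"
  have finV: "finite V"
    using finQ by (rule_tac finite_subset[of _ "Q \<times> Q"]) (auto simp: V_def)
  \<comment> \<open>Map (x, y, z) with x - y in \<open>E\<close> to (x + z, y + z). Two triples
    collide exactly when x - x', y - y' and z' - z agree, so collisions are counted by the cubes of
    \<open>r\<close>.\<close>
  have V_lower: "(real e * real \<Delta> * real b)\<^sup>2 \<le> real (card V) * (\<Sum>d\<in>DD. real (r d) ^ 3)"
  proof -
    define I where "I = {((x, y), z). x \<in> B \<and> y \<in> B \<and> z \<in> B \<and> x - y \<in> E}"
    define f where "f = (\<lambda>((x::real, y::real), z::real). (x + z, y + z))"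
    define K where "K = {(p, q). p \<in> I \<and> q \<in> I \<and> f q = f p}"
    have finI: "finite I"
      using B by (rule_tac finite_subset[of _ "(B \<times> B) \<times> B"]) (auto simp: I_def)
    have "e * \<Delta> * b = (\<Sum>d\<in>E. \<Delta>) * b" by (simp add: e_def)
    also have "\<dots> \<le> (\<Sum>d\<in>E. r d) * b"
      by (intro mult_le_mono1 sum_mono) (simp add: E_def)
    also have "\<dots> = card (Sigma E R \<times> B)"
      using finE finR by (simp add: r_def b_def card_cartesian_product)
    also have "\<dots> \<le> card I"
      using finI by (intro card_inj_on_le[of "\<lambda>((d, p), z). (p, z)"]) (auto simp: I_def R_def inj_on_def)
    finally have I: "e * \<Delta> * b \<le> card I" .
    have "card K \<le> card (Sigma DD (\<lambda>d. R d \<times> R d \<times> R d))"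
    proof (rule card_inj_on_le[of "\<lambda>(((x, y), z), ((x', y'), z')). (x - x', (x, x'), (y, y'), (z', z))"])
      show "(\<lambda>(((x, y), z), ((x', y'), z')). (x - x', (x, x'), (y, y'), (z', z))) ` K
          \<subseteq> Sigma DD (\<lambda>d. R d \<times> R d \<times> R d)"
        by (auto simp: K_def I_def f_def R_def DDI)
    qed (use finDD finR in \<open>auto simp: inj_on_def\<close>)
    also have "\<dots> = (\<Sum>d\<in>DD. (r d) ^ 3)"
      using finDD finR by (simp add: r_def card_cartesian_product power3_eq_cube mult.assoc)
    finally have K: "card K \<le> (\<Sum>d\<in>DD. (r d) ^ 3)" .
    have "f ` I \<subseteq> V" using QI by (auto simp: f_def I_def V_def)
    then have "card (f ` I) \<le> card V" using finV by (rule card_mono[rotated])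
    then have "card (f ` I) * card K \<le> card V * (\<Sum>d\<in>DD. (r d) ^ 3)" using K by (rule mult_le_mono)
    moreover have "(card I)\<^sup>2 \<le> card (f ` I) * card K"
      unfolding K_def by (rule card_cauchy_schwarz[OF finI])
    moreover have "(e * \<Delta> * b)\<^sup>2 \<le> (card I)\<^sup>2" using I by (rule power_mono) simp
    ultimately have "(e * \<Delta> * b)\<^sup>2 \<le> card V * (\<Sum>d\<in>DD. (r d) ^ 3)" by linarith
    then have "real ((e * \<Delta> * b)\<^sup>2) \<le> real (card V * (\<Sum>d\<in>DD. (r d) ^ 3))" by (rule of_nat_mono)
    then show ?thesis by simp
  qed

  define G where "G w = {(u, x). u \<in> Q \<and> x \<in> B \<and> u - x = w}" for w
  define g where "g w = card (G w)" for w
  define WW where "WW = (\<lambda>(u, x). u - x) ` (Q \<times> B)"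
  have finG: "finite (G w)" for w
    using B finQ by (rule_tac finite_subset[of _ "Q \<times> B"]) (auto simp: G_def)
  have finWW: "finite WW" using B finQ by (simp add: WW_def)
  have WWI: "u - x \<in> WW" if "u \<in> Q" "x \<in> B" for u x using that by (force simp: WW_def)
  have g_reps: "g w = reps B (uminus ` Q) (- w)" for w
    unfolding g_def reps_def
    by (rule bij_betw_same_card[of "\<lambda>(u, x). - u"], rule bij_betwI[where g = "\<lambda>c. (- c, - w - c)"])
      (auto simp: G_def image_iff intro: bexI[where x = "- _"])
  have g_le: "g w \<le> b" for w using g_reps reps_le_left[OF B(1)] by (simp add: b_def)
  define F where "F = (\<Sum>w\<in>WW. real (g w) ^ 2)"
  \<comment> \<open>If u - v = x - y then u - x = v - y, so each pair in \<open>V\<close> yields at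
    least \<Delta> pairs of representations of a common w.\<close>
  have VF: "real (card V) * real \<Delta> \<le> F"
  proof -
    have "card V * \<Delta> = (\<Sum>p\<in>V. \<Delta>)" by simp
    also have "\<dots> \<le> (\<Sum>p\<in>V. r (fst p - snd p))" by (intro sum_mono) (auto simp: V_def E_def)
    also have "\<dots> = card (Sigma V (\<lambda>p. R (fst p - snd p)))"
      using finV finR by (simp add: r_def)
    also have "\<dots> \<le> card (Sigma WW (\<lambda>w. G w \<times> G w))"
      using finWW finG by (intro card_inj_on_le[of "\<lambda>((u, v), (x, y)). (u - x, (u, x), (v, y))"])
        (auto simp: V_def R_def G_def inj_on_def WWI)
    also have "\<dots> = (\<Sum>w\<in>WW. (g w)\<^sup>2)"
      using finWW finG by (simp add: g_def card_cartesian_product power2_eq_square)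
    finally have "real (card V * \<Delta>) \<le> real (\<Sum>w\<in>WW. (g w)\<^sup>2)" by (rule of_nat_mono)
    then show ?thesis by (simp add: F_def)
  qed
  have F_upper: "F\<^sup>2 \<le> 4 * H\<^sup>2 * (D * real b * real s ^ 3)"
  proof -
    from level_set_sums[of WW b g, OF finWW b g_le] obtain t where t:
      "1 \<le> t" "t \<le> b" "t * card {w\<in>WW. t \<le> g w} \<le> sum g WW"
      "F \<le> 2 * harm b * (real t ^ 2 * real (card {w\<in>WW. t \<le> g w}))"
      unfolding F_def by blast
    define N where "N = real (card {w\<in>WW. t \<le> g w})"
    have "sum g WW = card (Sigma WW G)" using finWW finG by (simp add: g_def)
    also have "\<dots> \<le> card (Q \<times> B)"
      using finQ B by (intro card_inj_on_le[of snd]) (auto simp: G_def inj_on_def)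
    finally have "t * card {w\<in>WW. t \<le> g w} \<le> s * b"
      using t(3) by (simp add: card_cartesian_product s_def b_def)
    then have "real (t * card {w\<in>WW. t \<le> g w}) \<le> real (s * b)" by (rule of_nat_mono)
    then have 1: "real t * N \<le> real s * real b" by (simp add: N_def)
    have "real (card (uminus ` {w\<in>WW. t \<le> g w})) * real t ^ 3 \<le> D * (real (card (uminus ` Q)))\<^sup>2"
      using t(1) finQ finWW g_reps by (intro st) auto
    then have 2: "real t ^ 3 * N \<le> D * (real s)\<^sup>2"
      by (simp add: card_image N_def s_def mult.commute)
    \<comment> \<open>The second moment is interpolated between the trivial first moment t N <= s b
      and the third-moment bound.\<close>
    have "(real t ^ 2 * N)\<^sup>2 = (real t * N) * (real t ^ 3 * N)"
      by (simp add: power2_eq_square power3_eq_cube mult_ac)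
    also have "\<dots> \<le> (real s * real b) * (D * (real s)\<^sup>2)"
      by (intro mult_mono 1 2) (auto simp: N_def)
    also have "\<dots> = D * real b * real s ^ 3" by (simp add: power2_eq_square power3_eq_cube mult_ac)
    finally have 3: "(real t ^ 2 * N)\<^sup>2 \<le> D * real b * real s ^ 3" .
    have "F\<^sup>2 \<le> (2 * H * (real t ^ 2 * N))\<^sup>2"
      using t(4) by (intro power_mono) (auto simp: N_def H_def F_def intro!: sum_nonneg)
    also have "\<dots> = 4 * H\<^sup>2 * (real t ^ 2 * N)\<^sup>2" by (simp add: power_mult_distrib)
    also have "\<dots> \<le> 4 * H\<^sup>2 * (D * real b * real s ^ 3)" by (intro mult_left_mono 3) auto
    finally show ?thesis .
  qed

  define m where "m = real \<Delta> ^ 2 * real e"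
  have a2: "m ^ 3 \<le> 3 * H * D * F * (D * (real b)\<^sup>2)"
  proof -
    have "(real e * real \<Delta> * real b)\<^sup>2 * real \<Delta> \<le> real (card V) * (\<Sum>d\<in>DD. real (r d) ^ 3) * real \<Delta>"
      by (intro mult_right_mono V_lower) auto
    also have "\<dots> = (real (card V) * real \<Delta>) * (\<Sum>d\<in>DD. real (r d) ^ 3)" by simp
    also have "\<dots> \<le> F * (3 * H * (D * (real b)\<^sup>2))"
      by (intro mult_mono VF cubes) (auto simp: F_def intro!: sum_nonneg)
    finally have "(real b)\<^sup>2 * ((real e)\<^sup>2 * real \<Delta> ^ 3) \<le> (real b)\<^sup>2 * (3 * H * D * F)"
      by (simp add: power2_eq_square power3_eq_cube mult_ac)
    then have 1: "(real e)\<^sup>2 * real \<Delta> ^ 3 \<le> 3 * H * D * F" using b by simp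
    \<comment> \<open>The third-moment hypothesis for differences enters again, after
      \<open>cubes\<close>, through the factor e \<Delta>^3.\<close>
    have "m ^ 3 = ((real e)\<^sup>2 * real \<Delta> ^ 3) * (real e * real \<Delta> ^ 3)"
      by (simp add: m_def power2_eq_square power3_eq_cube mult_ac)
    also have "\<dots> \<le> (3 * H * D * F) * (D * (real b)\<^sup>2)"
      by (intro mult_mono 1 eD) (use H D in \<open>auto simp: F_def intro!: sum_nonneg mult_nonneg_nonneg\<close>)
    finally show ?thesis .
  qed
  have a1: "real b ^ 4 \<le> real s * (2 * H * m)"
    using energy mult_left_mono[OF \<Delta>(3), of "real s"]
    by (simp add: H_def m_def e_def E_def)
  have "real b ^ 19 \<le> 2304 * H ^ 10 * D ^ 5 * real s ^ 9"
    by (rule energy_chain[OF _ _ _ D H _ a1 a2 F_upper])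
      (use b in \<open>auto simp: m_def F_def intro!: sum_nonneg\<close>)
  then show ?thesis by (simp add: b_def H_def s_def Q_def)
qed

section \<open>Multiplicative structure of popular slopes\<close>

text \<open>The ranges used in pigeonholing are at most fixed powers of |A|, so all harmonic factors
  are absorbed into one logarithm.\<close>

lemma harm_power_le:
  assumes "n \<ge> 1" "m \<ge> 1" "m \<le> n ^ k" "k \<ge> 1"
  shows "harm m \<le> real k * (1 + ln (real n))"
proof -
  have "ln (real m) \<le> ln (real n ^ k)"
    using assms by (subst ln_le_cancel_iff) (auto simp flip: of_nat_power)
  also have "\<dots> = real k * ln (real n)" using assms by (simp add: ln_realpow)
  finally have "harm m \<le> 1 + real k * ln (real n)"
    using harm_le_ln[of m] assms by linarith
  also have "\<dots> \<le> real k * (1 + ln (real n))" using assms by (simp add: algebra_simps)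
  finally show ?thesis .
qed

definition slope_set :: "real set \<Rightarrow> real \<Rightarrow> real set"
  where "slope_set A \<mu> = {x\<in>A. \<mu> * x \<in> A}"

lemma finite_slope_set [simp]: "finite A \<Longrightarrow> finite (slope_set A \<mu>)"
  by (simp add: slope_set_def)

lemma card_slope_set_le: "finite A \<Longrightarrow> card (slope_set A \<mu>) \<le> card A"
  unfolding slope_set_def by (rule card_mono) auto

text \<open>Solymosi's inequality in energy form: apply \<open>solymosi_rich_slopes\<close> to the
  dominant level.\<close>

lemma multiplicative_energy_le:
  fixes A \<Theta> :: "real set"
  assumes A: "finite A" "A \<noteq> {}" and Apos: "\<And>a. a \<in> A \<Longrightarrow> a > 0" and \<Theta>: "finite \<Theta>"
  shows "(\<Sum>\<mu>\<in>\<Theta>. real (card (slope_set A \<mu>)) ^ 2)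
    \<le> 18 * (1 + ln (real (card A))) * (real (card (A + A)))\<^sup>2"
proof -
  have n: "card A \<ge> 1" using A by (simp add: Suc_le_eq card_gt_0_iff)
  from level_set_sums[of \<Theta> "card A" "\<lambda>\<mu>. card (slope_set A \<mu>)", OF \<Theta> n card_slope_set_le[OF A(1)]]
  obtain t where t: "(\<Sum>\<mu>\<in>\<Theta>. real (card (slope_set A \<mu>)) ^ 2)
      \<le> 2 * harm (card A) * (real t ^ 2 * real (card {\<mu>\<in>\<Theta>. t \<le> card (slope_set A \<mu>)}))"
    by blast
  have "card {\<mu>\<in>\<Theta>. t \<le> card (slope_set A \<mu>)} * t\<^sup>2 \<le> 9 * (card (A + A))\<^sup>2"
    using \<Theta> by (intro solymosi_rich_slopes[OF A(1) Apos]) (auto simp: slope_set_def)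
  then have "real (card {\<mu>\<in>\<Theta>. t \<le> card (slope_set A \<mu>)} * t\<^sup>2) \<le> real (9 * (card (A + A))\<^sup>2)"
    by (rule of_nat_mono)
  then have "real t ^ 2 * real (card {\<mu>\<in>\<Theta>. t \<le> card (slope_set A \<mu>)}) \<le> 9 * (real (card (A + A)))\<^sup>2"
    by (simp add: mult.commute)
  then have "harm (card A) * (real t ^ 2 * real (card {\<mu>\<in>\<Theta>. t \<le> card (slope_set A \<mu>)}))
      \<le> (1 + ln (real (card A))) * (9 * (real (card (A + A)))\<^sup>2)"
    by (rule mult_mono[OF harm_le_ln[OF n]]) (use n in simp_all)
  then show ?thesis using t by linarith
qed

text \<open>By Cauchy-Schwarz, n^4 is at most |AA| times the multiplicative energy, and one level
  \<tau> carries the energy up to a logarithm. The bound on \<tau> |S| holds because distinct lines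
  through the origin share no point of A x A.\<close>

lemma popular_slopes:
  fixes A :: "real set"
  assumes A: "finite A" "A \<noteq> {}" and Apos: "\<And>a. a \<in> A \<Longrightarrow> a > 0"
  obtains S \<tau> where "finite S" "S \<noteq> {}" "1 \<le> \<tau>" "\<tau> \<le> card A" "\<And>\<mu>. \<mu> \<in> S \<Longrightarrow> \<mu> > 0"
    "\<And>\<mu>. \<mu> \<in> S \<Longrightarrow> \<tau> \<le> card (slope_set A \<mu>)" "\<tau> * card S \<le> (card A)\<^sup>2"
    "real (card A) ^ 4 \<le> real (card (A * A)) * (2 * (1 + ln (real (card A))) * (real \<tau> ^ 2 * real (card S)))"
proof -
  define n where "n = card A"
  have n: "n \<ge> 1" using A by (simp add: n_def Suc_le_eq card_gt_0_iff)
  define \<Lambda> where "\<Lambda> = (\<lambda>(x, y). x / y) ` (A \<times> A)"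
  have fin\<Lambda>: "finite \<Lambda>" using A by (simp add: \<Lambda>_def)
  have \<Lambda>I: "x / y \<in> \<Lambda>" if "x \<in> A" "y \<in> A" for x y using that by (force simp: \<Lambda>_def)
  have \<Lambda>pos: "\<mu> > 0" if "\<mu> \<in> \<Lambda>" for \<mu> using that Apos by (auto simp: \<Lambda>_def)
  define r where "r \<mu> = card (slope_set A \<mu>)" for \<mu>
  have r_le: "r \<mu> \<le> n" for \<mu> using card_slope_set_le[OF A(1)] by (simp add: r_def n_def)
  define f where "f = (\<lambda>(x::real, y::real). x * y)"
  define K where "K = {(p, q). p \<in> A \<times> A \<and> q \<in> A \<times> A \<and> f q = f p}"
  have "card K \<le> card (Sigma \<Lambda> (\<lambda>\<mu>. slope_set A \<mu> \<times> slope_set A \<mu>))"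
  \<comment> \<open>If a b = c d, then \<mu> = a / c sends c to a and b to d, so b and c both lie in
    the slope set of \<mu>.\<close>
  proof (rule card_inj_on_le[of "\<lambda>((a, b), (c, d)). (a / c, (c, b))"])
    show "inj_on (\<lambda>((a, b), (c, d)). (a / c, (c, b))) K"
    proof (rule inj_onI)
      fix p q assume p: "p \<in> K" and q: "q \<in> K"
        and e: "(\<lambda>((a, b), (c, d)). (a / c, (c, b))) p = (\<lambda>((a, b), (c, d)). (a / c, (c, b))) q"
      obtain a b c d where p': "p = ((a, b), (c, d))" by (metis surj_pair)
      obtain a' d' where q': "q = ((a', b), (c, d'))" and a: "a / c = a' / c"
        using e unfolding p' by (cases q) auto
      have "c > 0" using p Apos by (auto simp: K_def p')
      moreover have "c * d = a * b" "c * d' = a' * b" using p q by (auto simp: K_def f_def p' q')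
      moreover have "a = a'" using a \<open>c > 0\<close> by simp
      ultimately have "d = d'" by (metis mult_cancel_left less_irrefl)
      then show "p = q" using \<open>a = a'\<close> by (simp add: p' q')
    qed
    show "(\<lambda>((a, b), (c, d)). (a / c, (c, b))) ` K \<subseteq> Sigma \<Lambda> (\<lambda>\<mu>. slope_set A \<mu> \<times> slope_set A \<mu>)"
    proof (rule image_subsetI)
      fix p assume p: "p \<in> K"
      obtain a b c d where p': "p = ((a, b), (c, d))" by (metis surj_pair)
      have mem: "a \<in> A" "b \<in> A" "c \<in> A" "d \<in> A" "c * d = a * b" "c > 0"
        using p Apos by (auto simp: K_def f_def p')
      then have "a / c * b = d" "a / c * c = a" by (auto simp: field_simps)
      then show "(\<lambda>((a, b), (c, d)). (a / c, (c, b))) p \<in> Sigma \<Lambda> (\<lambda>\<mu>. slope_set A \<mu> \<times> slope_set A \<mu>)"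
        using mem by (simp add: p' slope_set_def \<Lambda>I)
    qed
  qed (use fin\<Lambda> A in auto)
  also have "\<dots> = (\<Sum>\<mu>\<in>\<Lambda>. (r \<mu>)\<^sup>2)"
    using fin\<Lambda> A by (simp add: r_def card_cartesian_product power2_eq_square)
  finally have K: "card K \<le> (\<Sum>\<mu>\<in>\<Lambda>. (r \<mu>)\<^sup>2)" .
  have "f ` (A \<times> A) \<subseteq> A * A" by (auto simp: f_def intro: set_times_intro)
  then have "card (f ` (A \<times> A)) \<le> card (A * A)"
    using A by (intro card_mono finite_set_times) auto
  then have "card (f ` (A \<times> A)) * card K \<le> card (A * A) * (\<Sum>\<mu>\<in>\<Lambda>. (r \<mu>)\<^sup>2)"
    using K by (rule mult_le_mono)
  moreover have "(card (A \<times> A))\<^sup>2 \<le> card (f ` (A \<times> A)) * card K"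
    unfolding K_def using A by (intro card_cauchy_schwarz) auto
  ultimately have "n ^ 4 \<le> card (A * A) * (\<Sum>\<mu>\<in>\<Lambda>. (r \<mu>)\<^sup>2)"
    by (simp add: card_cartesian_product n_def power2_eq_square power4_eq_xxxx mult_ac)
  then have "real (n ^ 4) \<le> real (card (A * A) * (\<Sum>\<mu>\<in>\<Lambda>. (r \<mu>)\<^sup>2))" by (rule of_nat_mono)
  then have n4: "real n ^ 4 \<le> real (card (A * A)) * (\<Sum>\<mu>\<in>\<Lambda>. real (r \<mu>) ^ 2)" by simp
  from level_set_sums[of \<Lambda> n r, OF fin\<Lambda> n r_le] obtain \<tau> where \<tau>: "1 \<le> \<tau>" "\<tau> \<le> n"
    "\<tau> * card {\<mu>\<in>\<Lambda>. \<tau> \<le> r \<mu>} \<le> sum r \<Lambda>"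
    "(\<Sum>\<mu>\<in>\<Lambda>. real (r \<mu>) ^ 2) \<le> 2 * harm n * (real \<tau> ^ 2 * real (card {\<mu>\<in>\<Lambda>. \<tau> \<le> r \<mu>}))"
    by blast
  define S where "S = {\<mu>\<in>\<Lambda>. \<tau> \<le> r \<mu>}"
  have "sum r \<Lambda> = card (Sigma \<Lambda> (slope_set A))" using fin\<Lambda> A by (simp add: r_def)
  also have "\<dots> \<le> card (A \<times> A)"
    using A Apos by (intro card_inj_on_le[of "\<lambda>(\<mu>, x). (x, \<mu> * x)"])
      (auto simp: inj_on_def slope_set_def dest: less_imp_neq)
  finally have S2: "\<tau> * card S \<le> n\<^sup>2"
    using \<tau>(3) by (simp add: S_def card_cartesian_product power2_eq_square n_def)
  have "harm n * (real \<tau> ^ 2 * real (card S)) \<le> (1 + ln (real n)) * (real \<tau> ^ 2 * real (card S))"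
    using harm_le_ln[OF n] by (intro mult_right_mono) auto
  then have "(\<Sum>\<mu>\<in>\<Lambda>. real (r \<mu>) ^ 2) \<le> 2 * (1 + ln (real n)) * (real \<tau> ^ 2 * real (card S))"
    using \<tau>(4) unfolding S_def by linarith
  then have n4': "real n ^ 4 \<le> real (card (A * A)) * (2 * (1 + ln (real n)) * (real \<tau> ^ 2 * real (card S)))"
    using n4 mult_left_mono[of _ _ "real (card (A * A))"] by (meson of_nat_0_le_iff order_trans)
  have "S \<noteq> {}"
  proof
    assume "S = {}"
    then have "real n ^ 4 \<le> 0" using n4' by simp
    then show False using n by (simp add: power_le_zero_eq)
  qed
  show thesis
  proof (rule that[of S \<tau>])
    show "finite S" using fin\<Lambda> by (simp add: S_def)
  qed (use \<open>S \<noteq> {}\<close> \<tau> S2 n4' \<Lambda>pos in \<open>auto simp: S_def n_def r_def\<close>)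
qed

section \<open>Popular products\<close>

definition prod_reps :: "real set \<Rightarrow> real \<Rightarrow> (real \<times> real) set"
  where "prod_reps A p = {(a, b). a \<in> A \<and> b \<in> A \<and> b * a = p}"

text \<open>A product has n^2 / |AA| representations on average; popular means at least half of
  that.\<close>

definition popular_products :: "real set \<Rightarrow> real set"
  where "popular_products A = {p \<in> A * A. (card A)\<^sup>2 \<le> 2 * card (A * A) * card (prod_reps A p)}"

definition popular_part :: "real set \<Rightarrow> real set"
  where "popular_part A = {x\<in>A. card A \<le> 4 * card {a\<in>A. a * x \<in> popular_products A}}"

lemma finite_prod_reps [simp]: "finite A \<Longrightarrow> finite (prod_reps A p)"
  by (rule finite_subset[of _ "A \<times> A"]) (auto simp: prod_reps_def)

text \<open>Unpopular products account for at most n^2 / 2 pairs, and elements outside the popular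
  part for at most n^2 / 4 of the others; the remaining n^2 / 4 pairs need at least n / 4
  elements.\<close>

lemma card_popular_part:
  fixes A :: "real set"
  assumes A: "finite A"
  shows "card A \<le> 4 * card (popular_part A)"
proof (cases "A = {}")
  case False
  define n where "n = card A"
  define P where "P = card (A * A)"
  define P0 where "P0 = popular_products A"
  have n: "n \<ge> 1" using A False by (simp add: n_def Suc_le_eq card_gt_0_iff)
  have finAA: "finite (A * A)" using A by (intro finite_set_times)
  have finP0: "finite P0" using finAA by (simp add: P0_def popular_products_def)
  have sub: "P0 \<subseteq> A * A" by (auto simp: P0_def popular_products_def)
  define u where "u p = card (prod_reps A p)" for p
  have "A * A \<noteq> {}" using False by (auto intro: set_times_intro)
  then have P: "P > 0" using finAA by (simp add: P_def card_gt_0_iff)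
  have "n\<^sup>2 = card (Sigma (A * A) (prod_reps A))"
  proof -
    have "bij_betw snd (Sigma (A * A) (prod_reps A)) (A \<times> A)"
      by (rule bij_betwI[where g = "\<lambda>(a, b). (b * a, (a, b))"])
        (auto simp: prod_reps_def intro: set_times_intro)
    then show ?thesis
      using bij_betw_same_card by (fastforce simp: n_def card_cartesian_product power2_eq_square)
  qed
  also have "\<dots> = (\<Sum>p\<in>A * A. u p)" using A finAA by (simp add: u_def)
  also have "\<dots> = (\<Sum>p\<in>P0. u p) + (\<Sum>p\<in>A * A - P0. u p)"
    using sum.subset_diff[OF sub finAA] by (simp add: add.commute)
  finally have tot: "n\<^sup>2 = (\<Sum>p\<in>P0. u p) + (\<Sum>p\<in>A * A - P0. u p)" .
  have "2 * P * (\<Sum>p\<in>A * A - P0. u p) \<le> (\<Sum>p\<in>A * A - P0. n\<^sup>2)"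
    unfolding sum_distrib_left
    by (intro sum_mono) (auto simp: P0_def popular_products_def u_def P_def n_def)
  also have "\<dots> \<le> (\<Sum>p\<in>A * A. n\<^sup>2)" using finAA by (intro sum_mono2) auto
  finally have "P * (2 * (\<Sum>p\<in>A * A - P0. u p)) \<le> P * n\<^sup>2" by (simp add: P_def mult_ac)
  then have "2 * (\<Sum>p\<in>A * A - P0. u p) \<le> n\<^sup>2" using P by simp
  then have pop: "n\<^sup>2 \<le> 2 * (\<Sum>p\<in>P0. u p)" using tot by linarith
  define d where "d x = card {a\<in>A. a * x \<in> P0}" for x
  define A1 where "A1 = popular_part A"
  have A1: "A1 \<subseteq> A" by (auto simp: A1_def popular_part_def)
  have "(\<Sum>p\<in>P0. u p) = card (Sigma P0 (prod_reps A))" using A finP0 by (simp add: u_def)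
  also have "\<dots> \<le> card (Sigma A (\<lambda>x. {a\<in>A. a * x \<in> P0}))"
    using A by (intro card_inj_on_le[of "\<lambda>(p, (a, b)). (a, b)"]) (auto simp: inj_on_def prod_reps_def)
  also have "\<dots> = (\<Sum>x\<in>A. d x)" using A by (simp add: d_def)
  also have "\<dots> = (\<Sum>x\<in>A - A1. d x) + (\<Sum>x\<in>A1. d x)"
    by (rule sum.subset_diff[OF A1 A])
  finally have "4 * (\<Sum>p\<in>P0. u p) \<le> (\<Sum>x\<in>A - A1. 4 * d x) + 4 * (\<Sum>x\<in>A1. d x)"
    by (simp flip: sum_distrib_left)
  also have "(\<Sum>x\<in>A - A1. 4 * d x) \<le> (\<Sum>x\<in>A - A1. n)"
    by (intro sum_mono) (auto simp: A1_def popular_part_def d_def P0_def n_def)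
  also have "\<dots> \<le> (\<Sum>x\<in>A. n)" using A by (intro sum_mono2) auto
  also have "\<dots> = n\<^sup>2" by (simp add: n_def power2_eq_square)
  also have "(\<Sum>x\<in>A1. d x) \<le> (\<Sum>x\<in>A1. n)"
    unfolding d_def n_def using A by (intro sum_mono card_mono) auto
  finally have "n\<^sup>2 \<le> 4 * (card A1 * n)" using pop by (simp add: algebra_simps)
  then have "n * n \<le> n * (4 * card A1)" by (simp add: power2_eq_square mult_ac)
  then show ?thesis using n by (simp add: n_def A1_def)
qed auto


section \<open>From weighted multiplicative energy to many popular products\<close>

lemma sum_inj_image_le:
  assumes "finite J" "inj_on h I" "h ` I \<subseteq> J" "\<And>j. j \<in> J \<Longrightarrow> (0::real) \<le> g j"
  shows "(\<Sum>i\<in>I. g (h i)) \<le> (\<Sum>j\<in>J. g j)"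
proof -
  have "(\<Sum>i\<in>I. g (h i)) = (\<Sum>j\<in>h ` I. g j)" using assms(2) by (simp add: sum.reindex)
  also have "\<dots> \<le> (\<Sum>j\<in>J. g j)" using assms by (intro sum_mono2) auto
  finally show ?thesis .
qed

text \<open>If a x = b y and \<mu> = y / x, then \<mu> b = a and \<mu> x = y, so b and x lie in the
  slope sets of \<open>A\<close> and \<open>X\<close> for the same \<mu>. This separates
  \<open>A\<close> from the weighted set \<open>X\<close>.\<close>

lemma weighted_product_energy:
  fixes A X :: "real set" and w :: "real \<Rightarrow> nat"
  assumes A: "finite A" and X: "finite X" and pos: "\<And>x. x \<in> X \<Longrightarrow> x > 0"
    and I: "I \<subseteq> A \<times> X"
  defines "\<Theta> \<equiv> (\<lambda>(x, y). x / y) ` (X \<times> X)"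
  shows "(\<Sum>i\<in>I. real (w (snd i)) * (\<Sum>j\<in>{j\<in>I. fst j * snd j = fst i * snd i}. real (w (snd j))))
    \<le> (\<Sum>\<mu>\<in>\<Theta>. real (card (slope_set A \<mu>)) * real (weighted_ratio X w \<mu>))"
proof -
  define K where "K = Sigma I (\<lambda>i. {j\<in>I. fst j * snd j = fst i * snd i})"
  define J where "J = Sigma \<Theta> (\<lambda>\<mu>. slope_set A \<mu> \<times> slope_set X \<mu>)"
  define g where "g = (\<lambda>(\<mu>, (b::real, x)). real (w x) * real (w (\<mu> * x)))"
  define h where "h = (\<lambda>((a::real, x::real), (b::real, y)). (y / x, (b, x)))"
  have finI: "finite I" using A X I by (auto intro: finite_subset)
  have fin\<Theta>: "finite \<Theta>" using X by (simp add: \<Theta>_def)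
  have finJ: "finite J" using A X fin\<Theta> by (simp add: J_def)
  have mem: "a \<in> A \<and> x \<in> X \<and> b \<in> A \<and> y \<in> X \<and> b * y = a * x \<and> x > 0 \<and> y > 0"
    if "((a, x), (b, y)) \<in> K" for a x b y
    using that I pos by (auto simp: K_def)
  have "(\<Sum>i\<in>I. real (w (snd i)) * (\<Sum>j\<in>{j\<in>I. fst j * snd j = fst i * snd i}. real (w (snd j))))
      = (\<Sum>(i, j)\<in>K. real (w (snd i)) * real (w (snd j)))"
    unfolding K_def sum_distrib_left using finI by (subst sum.Sigma) auto
  also have "\<dots> = (\<Sum>k\<in>K. g (h k))"
  proof (rule sum.cong[OF refl])
    fix k assume k: "k \<in> K"
    obtain a x b y where k': "k = ((a, x), (b, y))" by (metis surj_pair)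
    show "(case k of (i, j) \<Rightarrow> real (w (snd i)) * real (w (snd j))) = g (h k)"
      using mem[of a x b y] k by (simp add: k' g_def h_def)
  qed
  also have "\<dots> \<le> (\<Sum>j\<in>J. g j)"
  proof (rule sum_inj_image_le[OF finJ])
    show "inj_on h K"
    proof (rule inj_onI)
      fix p q assume p: "p \<in> K" and q: "q \<in> K" and e: "h p = h q"
      obtain a x b y where p': "p = ((a, x), (b, y))" by (metis surj_pair)
      obtain a' x' b' y' where q': "q = ((a', x'), (b', y'))" by (metis surj_pair)
      note mp = mem[OF p[unfolded p']] and mq = mem[OF q[unfolded q']]
      have "x' = x" "b' = b" "y / x = y' / x" using e by (auto simp: h_def p' q')
      moreover from this have "y = y'" using mp by simp
      moreover from this \<open>x' = x\<close> \<open>b' = b\<close> have "a * x = a' * x" using mp mq by metis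
      ultimately show "p = q" using mp by (simp add: p' q')
    qed
    show "h ` K \<subseteq> J"
    proof (rule image_subsetI)
      fix k assume k: "k \<in> K"
      obtain a x b y where k': "k = ((a, x), (b, y))" by (metis surj_pair)
      note m = mem[OF k[unfolded k']]
      have "y / x \<in> \<Theta>" using m by (force simp: \<Theta>_def)
      moreover have "y / x * b = a" "y / x * x = y" using m by (auto simp: field_simps)
      ultimately show "h k \<in> J" using m by (simp add: k' h_def J_def slope_set_def)
    qed
  qed (auto simp: g_def J_def)
  also have "\<dots> = (\<Sum>\<mu>\<in>\<Theta>. \<Sum>p\<in>slope_set A \<mu> \<times> slope_set X \<mu>. g (\<mu>, p))"
    unfolding J_def using fin\<Theta> A X by (subst sum.Sigma) auto
  also have "\<dots> = (\<Sum>\<mu>\<in>\<Theta>. real (card (slope_set A \<mu>)) * real (weighted_ratio X w \<mu>))"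
  proof (rule sum.cong[OF refl])
    fix \<mu>
    have "(\<Sum>p\<in>slope_set A \<mu> \<times> slope_set X \<mu>. g (\<mu>, p))
        = (\<Sum>b\<in>slope_set A \<mu>. \<Sum>x\<in>slope_set X \<mu>. real (w x) * real (w (\<mu> * x)))"
      by (subst sum.cartesian_product) (simp add: g_def case_prod_beta)
    also have "\<dots> = real (card (slope_set A \<mu>)) * real (weighted_ratio X w \<mu>)"
      by (simp add: weighted_ratio_def slope_set_def)
    finally show "(\<Sum>p\<in>slope_set A \<mu> \<times> slope_set X \<mu>. g (\<mu>, p))
        = real (card (slope_set A \<mu>)) * real (weighted_ratio X w \<mu>)" .
  qed
  finally show ?thesis .
qed

lemma sum_weight_triples:
  assumes fin: "finite X" "finite Y" and \<beta>: "\<beta> \<noteq> 0"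
  shows "(\<Sum>x\<in>X. sum_weight ((*) \<beta> ` Y) ((*) \<gamma> ` Z) \<alpha> x) = card (linear_triples X Y Z \<alpha> \<beta> \<gamma>)"
proof -
  have "(\<Sum>x\<in>X. sum_weight ((*) \<beta> ` Y) ((*) \<gamma> ` Z) \<alpha> x)
      = card (Sigma X (\<lambda>x. {y \<in> (*) \<beta> ` Y. y + \<alpha> * x \<in> (*) \<gamma> ` Z}))"
    using fin by (simp add: sum_weight_def)
  also have "\<dots> = card (linear_triples X Y Z \<alpha> \<beta> \<gamma>)"
    using \<beta> by (intro bij_betw_same_card[of "\<lambda>(x, y). (x, y / \<beta>)"]
        bij_betwI[where g = "\<lambda>(x, y). (x, \<beta> * y)"]) (auto simp: linear_triples_def add.commute)
  finally show ?thesis .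
qed

text \<open>\<open>X\<close> has total weight at least 4 \<tau>^2 / M^2 and each x in
  \<open>X\<close> has at least n / 4 partners a with a x popular. The products rarely collide:
  after Cauchy-Schwarz over \<mu>, their weighted energy is controlled by Solymosi's inequality for
  \<open>A\<close> and by \<open>weighted_ratio_energy\<close> for \<open>X\<close>.\<close>

lemma many_popular_products:
  fixes A X Y Z :: "real set"
  assumes A: "finite A" and Apos: "\<And>a. a \<in> A \<Longrightarrow> a > 0"
    and X: "X \<subseteq> popular_part A" and Y: "finite Y" and Z: "finite Z"
    and card: "card X = \<tau>" "card Y = \<tau>" "card Z = \<tau>" and \<tau>: "\<tau> \<ge> 1"
    and nz: "\<alpha> \<noteq> 0" "\<beta> \<noteq> 0" "\<gamma> \<noteq> 0"
    and many: "4 * \<tau>\<^sup>2 \<le> M\<^sup>2 * card (linear_triples X Y Z \<alpha> \<beta> \<gamma>)"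
  shows "(real (card A))\<^sup>2 * real \<tau> \<le> 1024 * real M ^ 4 * (1 + ln (real (card A))) * real (card (A + A))
    * real (card {p \<in> popular_products A. \<exists>a\<in>A. \<exists>x\<in>X. p = a * x})"
proof -
  define n where "n = card A"
  define L where "L = 1 + ln (real n)"
  define Q where "Q = card (A + A)"
  define P0 where "P0 = popular_products A"
  define \<Omega> where "\<Omega> = {p \<in> P0. \<exists>a\<in>A. \<exists>x\<in>X. p = a * x}"
  define w where "w = sum_weight ((*) \<beta> ` Y) ((*) \<gamma> ` Z) \<alpha>"
  have XA: "X \<subseteq> A" using X by (auto simp: popular_part_def)
  have finX: "finite X" using XA A by (rule finite_subset)
  have "X \<noteq> {}" using card \<tau> by auto
  then have ne: "A \<noteq> {}" using XA by auto
  have n: "n \<ge> 1" using ne A by (simp add: n_def Suc_le_eq card_gt_0_iff)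
  have L: "L \<ge> 1" using n by (simp add: L_def)
  have \<tau>n: "\<tau> \<le> n" using XA A card card_mono by (metis n_def)
  have finP0: "finite P0"
    using finite_set_times[OF A A] by (simp add: P0_def popular_products_def)
  have fin\<Omega>: "finite \<Omega>" using finP0 by (simp add: \<Omega>_def)
  define I where "I = {(a, x). a \<in> A \<and> x \<in> X \<and> a * x \<in> P0}"
  have IAX: "I \<subseteq> A \<times> X" by (auto simp: I_def)
  have finI: "finite I" using IAX A finX by (auto intro: finite_subset)
  have lower: "n * \<tau>\<^sup>2 \<le> M\<^sup>2 * (\<Sum>i\<in>I. w (snd i))"
  proof -
    have "(\<Sum>i\<in>I. w (snd i)) = (\<Sum>x\<in>X. \<Sum>i\<in>{i\<in>I. snd i = x}. w (snd i))"
      by (rule sum.group[symmetric, OF finI finX]) (auto simp: I_def)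
    also have "\<dots> = (\<Sum>x\<in>X. card {a\<in>A. a * x \<in> P0} * w x)"
    proof (rule sum.cong[OF refl])
      fix x assume x: "x \<in> X"
      have "(\<Sum>i\<in>{i\<in>I. snd i = x}. w (snd i)) = card {i\<in>I. snd i = x} * w x" by simp
      also have "card {i\<in>I. snd i = x} = card {a\<in>A. a * x \<in> P0}"
        using x by (intro bij_betw_same_card[of fst] bij_betwI[where g = "\<lambda>a. (a, x)"]) (auto simp: I_def)
      finally show "(\<Sum>i\<in>{i\<in>I. snd i = x}. w (snd i)) = card {a\<in>A. a * x \<in> P0} * w x" .
    qed
    finally have eq: "4 * (\<Sum>i\<in>I. w (snd i)) = (\<Sum>x\<in>X. 4 * card {a\<in>A. a * x \<in> P0} * w x)"
      by (simp add: sum_distrib_left mult.assoc)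
    have "(\<Sum>x\<in>X. n * w x) \<le> (\<Sum>x\<in>X. 4 * card {a\<in>A. a * x \<in> P0} * w x)"
      using X by (intro sum_mono mult_le_mono1) (auto simp: popular_part_def n_def P0_def)
    then have "n * (\<Sum>x\<in>X. w x) \<le> 4 * (\<Sum>i\<in>I. w (snd i))"
      unfolding eq by (simp only: sum_distrib_left)
    then have "n * card (linear_triples X Y Z \<alpha> \<beta> \<gamma>) \<le> 4 * (\<Sum>i\<in>I. w (snd i))"
      using sum_weight_triples[OF finX Y nz(2), of \<gamma> Z \<alpha>] by (simp add: w_def)
    then have "M\<^sup>2 * (n * card (linear_triples X Y Z \<alpha> \<beta> \<gamma>)) \<le> M\<^sup>2 * (4 * (\<Sum>i\<in>I. w (snd i)))"
      by (rule mult_le_mono2)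
    moreover have "n * (4 * \<tau>\<^sup>2) \<le> n * (M\<^sup>2 * card (linear_triples X Y Z \<alpha> \<beta> \<gamma>))"
      using many by (rule mult_le_mono2)
    ultimately have "n * (4 * \<tau>\<^sup>2) \<le> M\<^sup>2 * (4 * (\<Sum>i\<in>I. w (snd i)))" by (simp only: mult.left_commute)
    then show ?thesis by simp
  qed
  define \<Theta> where "\<Theta> = (\<lambda>(x, y). x / y) ` (X \<times> X)"
  have fin\<Theta>: "finite \<Theta>" using finX by (simp add: \<Theta>_def)
  have Xpos: "x > 0" if "x \<in> X" for x using that XA Apos by auto
  have \<Theta>pos: "\<mu> > 0" if "\<mu> \<in> \<Theta>" for \<mu> using that Xpos by (auto simp: \<Theta>_def)
  define f where "f = (\<lambda>i::real \<times> real. fst i * snd i)"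
  define E where "E = (\<Sum>\<mu>\<in>\<Theta>. real (card (slope_set A \<mu>)) * real (weighted_ratio X w \<mu>))"
  have "(\<Sum>i\<in>I. real (w (snd i)))\<^sup>2 \<le> real (card (f ` I)) *
      (\<Sum>i\<in>I. real (w (snd i)) * (\<Sum>j\<in>{j\<in>I. f j = f i}. real (w (snd j))))"
    by (rule weighted_cauchy_schwarz[OF finI])
  also have "\<dots> \<le> real (card \<Omega>) * E"
  proof (rule mult_mono)
    have "f ` I \<subseteq> \<Omega>" unfolding f_def I_def \<Omega>_def by fastforce
    then show "real (card (f ` I)) \<le> real (card \<Omega>)" using fin\<Omega> by (simp add: card_mono)
    show "(\<Sum>i\<in>I. real (w (snd i)) * (\<Sum>j\<in>{j\<in>I. f j = f i}. real (w (snd j)))) \<le> E"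
      unfolding f_def E_def \<Theta>_def by (rule weighted_product_energy[OF A finX Xpos IAX])
  qed (auto intro!: sum_nonneg mult_nonneg_nonneg)
  finally have cs: "(\<Sum>i\<in>I. real (w (snd i)))\<^sup>2 \<le> real (card \<Omega>) * E" .
  have "E\<^sup>2 \<le> (\<Sum>\<mu>\<in>\<Theta>. (real (card (slope_set A \<mu>)))\<^sup>2) * (\<Sum>\<mu>\<in>\<Theta>. (real (weighted_ratio X w \<mu>))\<^sup>2)"
    unfolding E_def by (rule Cauchy_Schwarz_ineq_sum)
  also have "\<dots> \<le> (18 * L * (real Q)\<^sup>2) * (49152 * L * real \<tau> ^ 6)"
  proof (rule mult_mono)
    show "(\<Sum>\<mu>\<in>\<Theta>. (real (card (slope_set A \<mu>)))\<^sup>2) \<le> 18 * L * (real Q)\<^sup>2"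
      unfolding L_def n_def Q_def by (rule multiplicative_energy_le[OF A ne Apos fin\<Theta>])
    have "card ((*) \<beta> ` Y) \<le> \<tau>" "card ((*) \<gamma> ` Z) \<le> \<tau>"
      using card_image_le[OF Y] card_image_le[OF Z] card by metis+
    then have "(\<Sum>\<mu>\<in>\<Theta>. (real (weighted_ratio X w \<mu>))\<^sup>2) \<le> 16384 * harm (\<tau> ^ 3) * real \<tau> ^ 6"
      unfolding w_def using Y Z finX fin\<Theta> card \<tau> nz(1) \<Theta>pos Xpos
      by (intro weighted_ratio_energy) force+
    also have "\<dots> \<le> 16384 * (3 * L) * real \<tau> ^ 6"
    proof -
      have "harm (\<tau> ^ 3) \<le> real 3 * L" unfolding L_def
        using n \<tau> \<tau>n by (intro harm_power_le) (auto intro: power_mono)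
      then show ?thesis by (intro mult_right_mono mult_left_mono) auto
    qed
    finally show "(\<Sum>\<mu>\<in>\<Theta>. (real (weighted_ratio X w \<mu>))\<^sup>2) \<le> 49152 * L * real \<tau> ^ 6" by simp
  qed (use L in \<open>auto intro!: sum_nonneg\<close>)
  \<comment> \<open>884736 = 18 * 49152 is below 1024^2; 49152 is 3 * 16384, the 3 coming from the
    harmonic number of \<tau>^3.\<close>
  also have "\<dots> = 884736 * (L * real Q * real \<tau> ^ 3)\<^sup>2"
    by (simp add: power2_eq_square power_mult_distrib flip: power_add)
  also have "\<dots> \<le> (1024 * (L * real Q * real \<tau> ^ 3))\<^sup>2" by (simp add: power_mult_distrib)
  finally have E: "E \<le> 1024 * (L * real Q * real \<tau> ^ 3)"
    by (rule power2_le_imp_le) (use L in auto)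
  have "real (n * \<tau>\<^sup>2) \<le> real (M\<^sup>2 * (\<Sum>i\<in>I. w (snd i)))" using lower by (rule of_nat_mono)
  then have "real n * (real \<tau>)\<^sup>2 \<le> (real M)\<^sup>2 * (\<Sum>i\<in>I. real (w (snd i)))" by simp
  then have "(real n * (real \<tau>)\<^sup>2)\<^sup>2 \<le> ((real M)\<^sup>2 * (\<Sum>i\<in>I. real (w (snd i))))\<^sup>2"
    by (rule power_mono) auto
  also have "\<dots> = real M ^ 4 * (\<Sum>i\<in>I. real (w (snd i)))\<^sup>2"
    by (simp add: power_mult_distrib flip: power_mult)
  also have "\<dots> \<le> real M ^ 4 * (real (card \<Omega>) * (1024 * (L * real Q * real \<tau> ^ 3)))"
    by (intro mult_left_mono order_trans[OF cs mult_left_mono[OF E]]) simp_all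
  finally have "real \<tau> ^ 3 * ((real n)\<^sup>2 * real \<tau>) \<le> real \<tau> ^ 3 * (1024 * real M ^ 4 * L * real Q * real (card \<Omega>))"
    by (simp add: power2_eq_square power3_eq_cube mult_ac)
  then show ?thesis using \<tau> by (simp add: n_def L_def Q_def \<Omega>_def P0_def)
qed

text \<open>Each p in \<open>\<Omega> \<mu>\<close> has at least n^2 / (2 |AA|) factorisations p = b
  a in \<open>A\<close>, and a (\<mu> b) = \<mu> p is again in AA. Averaging the number of (\<mu>,
  a, b) over b yields a good dilate of \<open>G\<close>.\<close>

lemma popular_dilates:
  fixes A G :: "real set" and \<Omega> :: "real \<Rightarrow> real set"
  assumes A: "finite A" "A \<noteq> {}" and G: "finite G"
    and \<Omega>: "\<And>\<mu>. \<mu> \<in> G \<Longrightarrow> \<Omega> \<mu> \<subseteq> popular_products A"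
      "\<And>\<mu> p. \<mu> \<in> G \<Longrightarrow> p \<in> \<Omega> \<mu> \<Longrightarrow> \<mu> * p \<in> A * A"
    and large: "\<And>\<mu>. \<mu> \<in> G \<Longrightarrow> (real (card A))\<^sup>2 * \<tau> \<le> \<kappa> * real (card (\<Omega> \<mu>))" and \<kappa>: "\<kappa> \<ge> 0"
  obtains b where "b \<in> A" "real (card G) * real (card A) ^ 3 * \<tau>
    \<le> 2 * \<kappa> * real (card (A * A)) * real (\<Sum>a\<in>A. card {\<mu>\<in>G. a * (\<mu> * b) \<in> A * A})"
proof -
  define n where "n = card A"
  define P where "P = card (A * A)"
  have n: "n \<ge> 1" using A by (simp add: n_def Suc_le_eq card_gt_0_iff)
  define V where "V b = (\<Sum>a\<in>A. card {\<mu>\<in>G. a * (\<mu> * b) \<in> A * A})" for b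
  have finAA: "finite (A * A)" using A by (intro finite_set_times)
  have fin\<Omega>: "finite (\<Omega> \<mu>)" if "\<mu> \<in> G" for \<mu>
    by (rule finite_subset[OF \<Omega>(1)[OF that]]) (simp add: popular_products_def finAA)
  obtain b where b: "b \<in> A" "\<And>c. c \<in> A \<Longrightarrow> V c \<le> V b"
  proof -
    have "Max (V ` A) \<in> V ` A" using A by (intro Max_in) auto
    then obtain b where "b \<in> A" "Max (V ` A) = V b" by blast
    moreover have "V c \<le> Max (V ` A)" if "c \<in> A" for c using that A by (intro Max_ge) auto
    ultimately show thesis using that by metis
  qed
  have "(\<Sum>\<mu>\<in>G. n\<^sup>2 * card (\<Omega> \<mu>)) = (\<Sum>\<mu>\<in>G. \<Sum>p\<in>\<Omega> \<mu>. n\<^sup>2)" by (simp add: mult.commute)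
  also have "\<dots> \<le> (\<Sum>\<mu>\<in>G. \<Sum>p\<in>\<Omega> \<mu>. 2 * P * card (prod_reps A p))"
    using \<Omega>(1) by (intro sum_mono) (force simp: popular_products_def n_def P_def)
  also have "\<dots> = 2 * P * card (Sigma G (\<lambda>\<mu>. Sigma (\<Omega> \<mu>) (prod_reps A)))"
    using G fin\<Omega> A by (simp add: sum_distrib_left)
  also have "card (Sigma G (\<lambda>\<mu>. Sigma (\<Omega> \<mu>) (prod_reps A)))
      \<le> card (Sigma A (\<lambda>b. Sigma A (\<lambda>a. {\<mu>\<in>G. a * (\<mu> * b) \<in> A * A})))"
  proof (rule card_inj_on_le[of "\<lambda>(\<mu>, (p, (a, b))). (b, (a, \<mu>))"])
    show "inj_on (\<lambda>(\<mu>, (p, (a, b))). (b, (a, \<mu>))) (Sigma G (\<lambda>\<mu>. Sigma (\<Omega> \<mu>) (prod_reps A)))"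
      by (auto simp: inj_on_def prod_reps_def)
    show "(\<lambda>(\<mu>, (p, (a, b))). (b, (a, \<mu>))) ` (Sigma G (\<lambda>\<mu>. Sigma (\<Omega> \<mu>) (prod_reps A)))
        \<subseteq> Sigma A (\<lambda>b. Sigma A (\<lambda>a. {\<mu>\<in>G. a * (\<mu> * b) \<in> A * A}))"
    proof (rule image_subsetI)
      fix q assume q: "q \<in> Sigma G (\<lambda>\<mu>. Sigma (\<Omega> \<mu>) (prod_reps A))"
      obtain \<mu> p a b where q': "q = (\<mu>, (p, (a, b)))" by (metis surj_pair)
      have m: "\<mu> \<in> G" "p \<in> \<Omega> \<mu>" "a \<in> A" "b \<in> A" "b * a = p"
        using q by (auto simp: q' prod_reps_def)
      have "a * (\<mu> * b) = \<mu> * (b * a)" by (simp only: mult_ac)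
      then have mem: "a * (\<mu> * b) \<in> A * A" using \<Omega>(2)[OF m(1,2)] by (simp only: m(5))
      then show "(\<lambda>(\<mu>, (p, (a, b))). (b, (a, \<mu>))) q
          \<in> Sigma A (\<lambda>b. Sigma A (\<lambda>a. {\<mu>\<in>G. a * (\<mu> * b) \<in> A * A}))"
        using m(1,3,4) mem by (simp add: q')
    qed
  qed (use A G in auto)
  also have "\<dots> = (\<Sum>b\<in>A. V b)" using A G by (simp add: V_def)
  also have "\<dots> \<le> (\<Sum>c\<in>A. V b)" using b by (intro sum_mono)
  finally have "(\<Sum>\<mu>\<in>G. n\<^sup>2 * card (\<Omega> \<mu>)) \<le> 2 * P * (n * V b)" by (simp add: n_def)
  then have "real (\<Sum>\<mu>\<in>G. n\<^sup>2 * card (\<Omega> \<mu>)) \<le> real (2 * P * (n * V b))" by (rule of_nat_mono)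
  then have 1: "(\<Sum>\<mu>\<in>G. (real n)\<^sup>2 * real (card (\<Omega> \<mu>))) \<le> 2 * real P * (real n * real (V b))" by simp
  have "real (card G) * ((real n)\<^sup>2 * ((real n)\<^sup>2 * \<tau>)) = (\<Sum>\<mu>\<in>G. (real n)\<^sup>2 * ((real n)\<^sup>2 * \<tau>))" by simp
  also have "\<dots> \<le> (\<Sum>\<mu>\<in>G. (real n)\<^sup>2 * (\<kappa> * real (card (\<Omega> \<mu>))))"
    using large by (intro sum_mono mult_left_mono) (auto simp: n_def)
  also have "\<dots> = \<kappa> * (\<Sum>\<mu>\<in>G. (real n)\<^sup>2 * real (card (\<Omega> \<mu>)))"
    by (simp add: sum_distrib_left mult_ac)
  also have "\<dots> \<le> \<kappa> * (2 * real P * (real n * real (V b)))" by (intro mult_left_mono 1 \<kappa>)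
  finally have "real n * (real (card G) * real n ^ 3 * \<tau>) \<le> real n * (2 * \<kappa> * real P * real (V b))"
    by (simp add: power2_eq_square power3_eq_cube mult_ac)
  then have "real (card G) * real n ^ 3 * \<tau> \<le> 2 * \<kappa> * real P * real (V b)" using n by simp
  with b(1) show thesis using that by (simp add: n_def P_def V_def)
qed

text \<open>The fifth power of the denominator T^3 uses up T^15 of the T^19 in the bound for V^19;
  the remaining T^4 is at most g^4, which turns g^10 into g^14.\<close>

lemma dilates_algebra:
  fixes T B g P Q L V :: real
  assumes nn: "T \<ge> 1" "B \<ge> 0" "g \<ge> T" "P \<ge> 0" "Q \<ge> 0" "L \<ge> 0" "V \<ge> 0" "c \<ge> 0"
    and V: "V \<le> 2 * L * (T * B)"
    and B: "B ^ 19 \<le> 2304 * L ^ 10 * (c * g\<^sup>2 * P\<^sup>2 / T ^ 3) ^ 5 * Q ^ 9"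
  shows "V ^ 19 \<le> 2 ^ 19 * 2304 * c ^ 5 * (L ^ 29 * g ^ 14 * P ^ 10 * Q ^ 9)"
proof -
  have T0: "T > 0" using nn by linarith
  have "T ^ 15 = (T ^ 3) ^ 5" by (simp flip: power_mult)
  then have "T ^ 15 * (c * g\<^sup>2 * P\<^sup>2 / T ^ 3) ^ 5 = (T ^ 3 * (c * g\<^sup>2 * P\<^sup>2 / T ^ 3)) ^ 5"
    by (simp only: power_mult_distrib)
  also have "\<dots> = (c * g\<^sup>2 * P\<^sup>2) ^ 5" using T0 by simp
  also have "\<dots> = c ^ 5 * g ^ 10 * P ^ 10" by (simp add: power_mult_distrib flip: power_mult)
  finally have D: "T ^ 15 * (c * g\<^sup>2 * P\<^sup>2 / T ^ 3) ^ 5 = c ^ 5 * g ^ 10 * P ^ 10" .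
  have "T ^ 15 * B ^ 19 \<le> T ^ 15 * (2304 * L ^ 10 * (c * g\<^sup>2 * P\<^sup>2 / T ^ 3) ^ 5 * Q ^ 9)"
    using T0 by (intro mult_left_mono B) auto
  also have "\<dots> = 2304 * L ^ 10 * (T ^ 15 * (c * g\<^sup>2 * P\<^sup>2 / T ^ 3) ^ 5) * Q ^ 9" by (simp only: mult_ac)
  also have "\<dots> = 2304 * L ^ 10 * (c ^ 5 * g ^ 10 * P ^ 10) * Q ^ 9" by (simp only: D)
  finally have TB: "T ^ 15 * B ^ 19 \<le> 2304 * L ^ 10 * (c ^ 5 * g ^ 10 * P ^ 10) * Q ^ 9" .
  have "V ^ 19 \<le> (2 * L * (T * B)) ^ 19" using nn V by (intro power_mono)
  also have "\<dots> = 2 ^ 19 * L ^ 19 * (T ^ 19 * B ^ 19)" by (simp only: power_mult_distrib)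
  also have "T ^ 19 = T ^ 4 * T ^ 15" by (simp flip: power_add)
  also have "2 ^ 19 * L ^ 19 * (T ^ 4 * T ^ 15 * B ^ 19) = 2 ^ 19 * L ^ 19 * (T ^ 4 * (T ^ 15 * B ^ 19))"
    by (simp only: mult_ac)
  also have "\<dots> \<le> 2 ^ 19 * L ^ 19 * (g ^ 4 * (2304 * L ^ 10 * (c ^ 5 * g ^ 10 * P ^ 10) * Q ^ 9))"
    using nn T0 by (intro mult_left_mono mult_mono power_mono TB) auto
  also have "\<dots> = 2 ^ 19 * 2304 * c ^ 5 * ((L ^ 19 * L ^ 10) * (g ^ 4 * g ^ 10) * P ^ 10 * Q ^ 9)"
    by (simp only: mult_ac)
  also have "\<dots> = 2 ^ 19 * 2304 * c ^ 5 * (L ^ 29 * g ^ 14 * P ^ 10 * Q ^ 9)"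
    by (simp only: power_add[symmetric]) simp
  finally show ?thesis .
qed

text \<open>One level \<open>T\<close> and the set \<open>B\<close> of elements with at least
  \<open>T\<close> partners in \<open>R\<close> carry the sum up to a logarithm. Elements of
  \<open>B\<close> are quotients of AA by \<open>R\<close> in at least \<open>T\<close> ways, so
  \<open>rich_sums\<close> supplies the third-moment hypothesis of
  \<open>sumset_lower_bound\<close>, and B + B lies in A + A.\<close>

lemma dilates_bound:
  fixes A R :: "real set"
  assumes A: "finite A" "A \<noteq> {}" and Apos: "\<And>a. a \<in> A \<Longrightarrow> a > 0"
    and R: "finite R" "R \<noteq> {}" and Rpos: "\<And>u. u \<in> R \<Longrightarrow> u > 0" and R2: "card R \<le> (card A)\<^sup>2"
  shows "real (\<Sum>a\<in>A. card {u\<in>R. a * u \<in> A * A}) ^ 19 \<le> 2 ^ 19 * 2304 * 2048 ^ 5 *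
    ((1 + ln (real (card A))) ^ 29 * real (card R) ^ 14 * real (card (A * A)) ^ 10 * real (card (A + A)) ^ 9)"
proof -
  define n where "n = card A"
  define L where "L = 1 + ln (real n)"
  define P where "P = card (A * A)"
  define Q where "Q = card (A + A)"
  define g where "g = card R"
  have n: "n \<ge> 1" using A by (simp add: n_def Suc_le_eq card_gt_0_iff)
  have L: "L \<ge> 1" using n by (simp add: L_def)
  have g: "g \<ge> 1" using R by (simp add: g_def Suc_le_eq card_gt_0_iff)
  have finAA: "finite (A * A)" using A by (intro finite_set_times)
  have AApos: "p > 0" if "p \<in> A * A" for p using that Apos by (auto simp: set_times_def)
  have AP: "card A \<le> P"
  proof -
    obtain a where a: "a \<in> A" using A by blast
    then have "a > 0" by (rule Apos)
    then show ?thesis unfolding P_def using a finAA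
      by (intro card_inj_on_le[of "\<lambda>x. x * a"]) (auto simp: inj_on_def)
  qed
  define d where "d a = card {u\<in>R. a * u \<in> A * A}" for a
  define V where "V = (\<Sum>a\<in>A. d a)"
  have d_le: "d a \<le> g" for a unfolding d_def g_def using R by (intro card_mono) auto
  from level_set[of A g d 1, OF A(1) g d_le order_refl] obtain T where T: "1 \<le> T" "T \<le> g"
    "(\<Sum>a\<in>A. real (d a) ^ 1) \<le> real 1 * harm g * (real T ^ 1 * real (card {a\<in>A. T \<le> d a}))"
    by blast
  define B where "B = {a\<in>A. T \<le> d a}"
  have BA: "B \<subseteq> A" by (auto simp: B_def)
  have finB: "finite B" using BA A by (auto intro: finite_subset)
  have "harm g \<le> real 2 * L" unfolding L_def
    using n g R2 by (intro harm_power_le) (auto simp: g_def n_def)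
  then have "harm g * (real T * real (card B)) \<le> 2 * L * (real T * real (card B))"
    by (intro mult_right_mono) auto
  then have V: "real V \<le> 2 * L * (real T * real (card B))"
    using T(3) by (simp add: V_def B_def)
  have "real V ^ 19 \<le> 2 ^ 19 * 2304 * 2048 ^ 5 * (L ^ 29 * real g ^ 14 * real P ^ 10 * real Q ^ 9)"
  proof (cases "B = {}")
    case True
    then have "real V \<le> 0" using V by simp
    then have "V = 0" by simp
    then show ?thesis using L by simp
  next
    case False
    define D where "D = 2048 * (real g)\<^sup>2 * (real P)\<^sup>2 / real T ^ 3"
    have st: "real (card X) * real t ^ 3 \<le> D * (real (card C))\<^sup>2"
      if "finite C" "finite X" "t \<ge> 1" "\<And>x. x \<in> X \<Longrightarrow> t \<le> reps B C x" for C X t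
    proof -
      have "card X * (T * t) ^ 3 \<le> 2048 * ((card R)\<^sup>2 * (card (A * A))\<^sup>2 * (card C)\<^sup>2)"
      proof (rule rich_sums[OF finB that(1) R(1) finAA that(2) Rpos AApos _ _ that(3,4)])
        show "card B \<le> card (A * A)"
          using card_mono[OF A(1) BA] AP by (simp add: P_def)
      qed (auto simp: B_def d_def)
      then have "real (card X * (T * t) ^ 3) \<le> real (2048 * ((card R)\<^sup>2 * (card (A * A))\<^sup>2 * (card C)\<^sup>2))"
        by (rule of_nat_mono)
      then show ?thesis using T(1)
        by (simp add: D_def g_def P_def field_simps power_mult_distrib)
    qed
    have D: "D \<ge> 0" by (simp add: D_def)
    have "real (card B) ^ 19 \<le> 2304 * harm (card B) ^ 10 * D ^ 5 * real (card (B + B)) ^ 9"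
      by (rule sumset_lower_bound[OF finB False D st])
    also have "\<dots> \<le> 2304 * L ^ 10 * D ^ 5 * real Q ^ 9"
    proof -
      have cB: "card B \<ge> 1" using finB False by (simp add: Suc_le_eq card_gt_0_iff)
      have "harm (card B) \<le> real 1 * L" unfolding L_def
        using n cB card_mono[OF A(1) BA] by (intro harm_power_le) (auto simp: n_def)
      moreover have "card (B + B) \<le> Q" unfolding Q_def
        using BA A by (intro card_mono finite_set_plus set_plus_mono2) auto
      ultimately show ?thesis using L D
        by (intro mult_mono power_mono) (auto simp: harm_nonneg)
    qed
    finally have "real (card B) ^ 19 \<le> 2304 * L ^ 10 * D ^ 5 * real Q ^ 9" .
    then show ?thesis unfolding D_def
      using L T V by (intro dilates_algebra[of "real T" "real (card B)"]) auto
  qed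
  then show ?thesis by (simp only: V_def d_def L_def n_def g_def P_def Q_def)
qed

text \<open>The 19th power serves to insert \<open>h5\<close>. Afterwards \<sigma>^81 \<tau>^171
  n^57 is bounded, and \<open>h1\<close> to the power 81 with n^2 <= c P L \<tau> to the power 9
  produces just these powers of \<sigma> and \<tau>; 324 + 18 + 57 = 399.\<close>

lemma many_good_slopes_algebra:
  fixes n L P Q \<sigma> \<tau> V M c k m K :: real
  assumes nn: "n > 0" "L \<ge> 0" "P \<ge> 0" "Q \<ge> 0" "\<sigma> > 0" "\<tau> > 0" "V \<ge> 0" "M \<ge> 0" "c \<ge> 0" "k \<ge> 0" "m \<ge> 0" "K \<ge> 0"
    and h1: "n ^ 4 \<le> c * (P * L * (\<tau>\<^sup>2 * \<sigma>))"
    and h2: "\<tau> * \<sigma> \<le> n\<^sup>2"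
    and h3: "\<sigma> * n ^ 3 * \<tau> \<le> k * (M ^ 4 * L * Q * P * V)"
    and h4: "M * (\<sigma> * \<tau>\<^sup>2) \<le> m * Q\<^sup>2"
    and h5: "V ^ 19 \<le> K * (L ^ 29 * \<sigma> ^ 14 * P ^ 10 * Q ^ 9)"
  shows "n ^ 399 \<le> (c ^ 90 * (k * m ^ 4) ^ 19 * K) * (L ^ 138 * P ^ 119 * Q ^ 180)"
proof -
  \<comment> \<open>The left side of \<open>h3\<close> times (\<sigma> \<tau>^2)^4: the factor M^4
    in \<open>h3\<close> is paid for by four uses of \<open>h4\<close>.\<close>
  define X where "X = \<sigma> ^ 5 * \<tau> ^ 9 * n ^ 3"
  have "\<sigma> ^ 5 = \<sigma> * \<sigma> ^ 4" "\<tau> ^ 9 = \<tau> * \<tau> ^ 8" by (simp_all flip: power_Suc)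
  then have "X = (\<sigma> * n ^ 3 * \<tau>) * (\<sigma> * \<tau>\<^sup>2) ^ 4"
    by (simp add: X_def power_mult_distrib flip: power_mult)
  also have "\<dots> \<le> (k * (M ^ 4 * L * Q * P * V)) * (\<sigma> * \<tau>\<^sup>2) ^ 4"
    using nn by (intro mult_right_mono h3) auto
  also have "\<dots> = k * (L * Q * P * V) * (M * (\<sigma> * \<tau>\<^sup>2)) ^ 4"
    by (simp add: power_mult_distrib)
  also have "\<dots> \<le> k * (L * Q * P * V) * (m * Q\<^sup>2) ^ 4"
    using nn by (intro mult_left_mono power_mono h4) auto
  also have "\<dots> = (k * m ^ 4) * (L * P * (Q * Q ^ 8) * V)"
    by (simp add: power_mult_distrib flip: power_mult)
  also have "Q * Q ^ 8 = Q ^ 9" by (simp flip: power_Suc)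
  finally have X: "X \<le> (k * m ^ 4) * (L * P * Q ^ 9 * V)" .
  have X0: "X \<ge> 0" using nn by (simp add: X_def)
  have "X ^ 19 \<le> ((k * m ^ 4) * (L * P * Q ^ 9 * V)) ^ 19" by (rule power_mono[OF X X0])
  also have "\<dots> = (k * m ^ 4) ^ 19 * (L ^ 19 * P ^ 19 * Q ^ 171 * V ^ 19)"
    by (simp only: power_mult_distrib power_mult[symmetric]) simp
  also have "\<dots> \<le> (k * m ^ 4) ^ 19 * (L ^ 19 * P ^ 19 * Q ^ 171 * (K * (L ^ 29 * \<sigma> ^ 14 * P ^ 10 * Q ^ 9)))"
    using nn by (intro mult_left_mono h5) auto
  also have "\<dots> = \<sigma> ^ 14 * ((k * m ^ 4) ^ 19 * K * ((L ^ 19 * L ^ 29) * (P ^ 19 * P ^ 10) * (Q ^ 171 * Q ^ 9)))"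
    by (simp only: mult_ac)
  also have "\<dots> = \<sigma> ^ 14 * ((k * m ^ 4) ^ 19 * K * (L ^ 48 * P ^ 29 * Q ^ 180))"
    by (simp only: power_add[symmetric]) simp
  finally have "X ^ 19 \<le> \<sigma> ^ 14 * ((k * m ^ 4) ^ 19 * K * (L ^ 48 * P ^ 29 * Q ^ 180))" .
  moreover have "X ^ 19 = \<sigma> ^ 14 * (\<sigma> ^ 81 * \<tau> ^ 171 * n ^ 57)"
  proof -
    have "\<sigma> ^ 95 = \<sigma> ^ 14 * \<sigma> ^ 81" by (simp flip: power_add)
    then show ?thesis by (simp add: X_def power_mult_distrib flip: power_mult)
  qed
  ultimately have b: "\<sigma> ^ 81 * \<tau> ^ 171 * n ^ 57 \<le> (k * m ^ 4) ^ 19 * K * (L ^ 48 * P ^ 29 * Q ^ 180)"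
    using nn by simp
  \<comment> \<open>Combining \<open>h1\<close> with \<open>h2\<close> removes \<sigma>; this
    supplies the extra \<tau>^9.\<close>
  have "n ^ 4 \<le> c * (P * L * (\<tau> * (\<tau> * \<sigma>)))" using h1 by (simp add: power2_eq_square mult_ac)
  also have "\<dots> \<le> c * (P * L * (\<tau> * n\<^sup>2))" using nn by (intro mult_left_mono h2) auto
  also have "\<dots> = n\<^sup>2 * (c * (P * L * \<tau>))" by (simp only: mult_ac)
  finally have "n\<^sup>2 * n\<^sup>2 \<le> n\<^sup>2 * (c * (P * L * \<tau>))" by (simp flip: power_add)
  moreover have "n\<^sup>2 > 0" using nn by simp
  ultimately have c2: "n\<^sup>2 \<le> c * (P * L * \<tau>)" by (simp only: mult_le_cancel_left_pos)
  have "n ^ 399 = (n ^ 4) ^ 81 * (n\<^sup>2) ^ 9 * n ^ 57" by (simp only: power_mult[symmetric] power_add[symmetric]) simp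
  also have "\<dots> \<le> (c * (P * L * (\<tau>\<^sup>2 * \<sigma>))) ^ 81 * (c * (P * L * \<tau>)) ^ 9 * n ^ 57"
    using nn by (intro mult_mono power_mono h1 c2) auto
  also have "\<dots> = (c ^ 81 * c ^ 9) * ((L ^ 81 * L ^ 9) * (P ^ 81 * P ^ 9)) * (\<sigma> ^ 81 * ((\<tau>\<^sup>2) ^ 81 * \<tau> ^ 9) * n ^ 57)"
    by (simp only: power_mult_distrib mult_ac)
  also have "\<dots> = c ^ 90 * (L ^ 90 * P ^ 90) * (\<sigma> ^ 81 * \<tau> ^ 171 * n ^ 57)"
    by (simp only: power_add[symmetric] power_mult[symmetric]) simp
  also have "\<dots> \<le> c ^ 90 * (L ^ 90 * P ^ 90) * ((k * m ^ 4) ^ 19 * K * (L ^ 48 * P ^ 29 * Q ^ 180))"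
    using nn by (intro mult_left_mono b) auto
  also have "\<dots> = (c ^ 90 * (k * m ^ 4) ^ 19 * K) * ((L ^ 90 * L ^ 48) * (P ^ 90 * P ^ 29) * Q ^ 180)"
    by (simp only: mult_ac)
  also have "\<dots> = (c ^ 90 * (k * m ^ 4) ^ 19 * K) * (L ^ 138 * P ^ 119 * Q ^ 180)"
    by (simp only: power_add[symmetric]) simp
  finally show ?thesis .
qed

section \<open>The sum-product bound\<close>

text \<open>The constants of the two cases of \<open>sum_product_positive\<close> are added, so that
  the sum dominates each.\<close>

definition sum_product_const :: real
  where "sum_product_const = 512 ^ 90 * (4096 * 66 ^ 4) ^ 19 * (2 ^ 19 * 2304 * 2048 ^ 5) + 6144 ^ 119"

lemma sum_product_const_bounds:
  "sum_product_const > 0"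
  "512 ^ 90 * (4096 * 66 ^ 4) ^ 19 * (2 ^ 19 * 2304 * 2048 ^ 5) \<le> sum_product_const"
  "6144 ^ 119 \<le> sum_product_const"
  unfolding sum_product_const_def
    apply (intro add_pos_pos mult_pos_pos zero_less_power zero_less_numeral)
   apply (simp only: le_add_same_cancel1, intro zero_le_power zero_le_numeral)
  apply (simp only: le_add_same_cancel2, intro mult_nonneg_nonneg zero_le_power zero_le_numeral)
  done

text \<open>The 119th power of \<open>h\<close> has the right power of P, n^42 <= Q^42 supplies the
  missing powers of n, and the surplus in L and Q is given away.\<close>

lemma few_slopes_algebra:
  fixes n L P Q :: real
  assumes nn: "n > 0" "L \<ge> 1" "P \<ge> 0" "n \<le> Q" "Q \<ge> 1" and h: "n ^ 3 \<le> c * (P * L * Q)" and c: "c \<ge> 0"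
  shows "n ^ 399 \<le> c ^ 119 * (L ^ 138 * P ^ 119 * Q ^ 180)"
proof -
  have "n ^ 399 = (n ^ 3) ^ 119 * n ^ 42" by (simp only: power_mult[symmetric] power_add[symmetric]) simp
  also have "\<dots> \<le> (c * (P * L * Q)) ^ 119 * Q ^ 42"
    using nn c by (intro mult_mono power_mono h) auto
  also have "\<dots> = c ^ 119 * (L ^ 119 * P ^ 119 * (Q ^ 119 * Q ^ 42))"
    by (simp only: power_mult_distrib mult_ac)
  also have "\<dots> = c ^ 119 * (L ^ 119 * P ^ 119 * Q ^ 161)"
    by (simp only: power_add[symmetric]) simp
  also have "\<dots> \<le> c ^ 119 * (L ^ 138 * P ^ 119 * Q ^ 180)"
    using nn c by (intro mult_left_mono mult_mono[OF mult_right_mono[OF power_increasing] power_increasing]) auto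
  finally show ?thesis .
qed

text \<open>Slopes are taken from the popular part so that the sets \<open>X \<mu>\<close> fit
  \<open>many_popular_products\<close>. Either at least half of them lie in \<open>G\<close>, or
  there are at most 2 M of them, since M slopes outside \<open>G\<close> would already form clusters
  with too many sums.\<close>

lemma sum_product_positive:
  fixes A :: "real set"
  assumes A: "finite A" "A \<noteq> {}" and Apos: "\<And>a. a \<in> A \<Longrightarrow> a > 0"
  shows "real (card A) ^ 399 \<le> sum_product_const *
    ((1 + ln (real (card A))) ^ 138 * real (card (A * A)) ^ 119 * real (card (A + A)) ^ 180)"
proof -
  define n where "n = card A"
  define L where "L = 1 + ln (real n)"
  define P where "P = card (A * A)"
  define Q where "Q = card (A + A)"
  have n: "n \<ge> 1" using A by (simp add: n_def Suc_le_eq card_gt_0_iff)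
  have L: "L \<ge> 1" using n by (simp add: L_def)
  have nQ: "n \<le> Q" unfolding n_def Q_def by (rule card_le_card_sumset[OF A(1) A])
  have finAA: "finite (A * A)" using A by (intro finite_set_times)
  define A1 where "A1 = popular_part A"
  have A1: "A1 \<subseteq> A" by (auto simp: A1_def popular_part_def)
  have finA1: "finite A1" using A1 A by (auto intro: finite_subset)
  have n1: "n \<le> 4 * card A1" unfolding n_def A1_def by (rule card_popular_part[OF A(1)])
  then have A1ne: "A1 \<noteq> {}" using n by auto
  have cA1: "card A1 \<le> n" unfolding n_def by (rule card_mono[OF A(1) A1])
  have A1pos: "a > 0" if "a \<in> A1" for a using that A1 Apos by auto
  obtain S \<tau> where S: "finite S" "S \<noteq> {}" "1 \<le> \<tau>" "\<tau> \<le> card A1" "\<And>\<mu>. \<mu> \<in> S \<Longrightarrow> \<mu> > 0"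
    "\<And>\<mu>. \<mu> \<in> S \<Longrightarrow> \<tau> \<le> card (slope_set A1 \<mu>)" "\<tau> * card S \<le> (card A1)\<^sup>2"
    and e1: "real (card A1) ^ 4 \<le> real (card (A1 * A1)) * (2 * (1 + ln (real (card A1))) * (real \<tau> ^ 2 * real (card S)))"
    using popular_slopes[OF finA1 A1ne A1pos] by metis
  define \<sigma> where "\<sigma> = card S"
  have \<sigma>: "\<sigma> \<ge> 1" using S by (simp add: \<sigma>_def Suc_le_eq card_gt_0_iff)
  have \<tau>\<sigma>: "\<tau> * \<sigma> \<le> n\<^sup>2" unfolding \<sigma>_def
    by (rule order_trans[OF S(7) power_mono[OF cA1 le0]])
  have h1: "real n ^ 4 \<le> 512 * (real P * L * ((real \<tau>)\<^sup>2 * real \<sigma>))"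
  proof -
    have "real n ^ 4 \<le> (4 * real (card A1)) ^ 4"
      using n1 by (intro power_mono) (simp_all add: of_nat_mono)
    also have "\<dots> = 256 * real (card A1) ^ 4" by (simp add: power_mult_distrib)
    also have "real (card A1) ^ 4 \<le> real P * (2 * L * (real \<tau> ^ 2 * real \<sigma>))"
    proof (rule order_trans[OF e1])
      have "card (A1 * A1) \<le> P" unfolding P_def
        using A1 finAA by (intro card_mono set_times_mono2) auto
      moreover have "ln (real (card A1)) \<le> ln (real n)"
        using cA1 n1 n by (subst ln_le_cancel_iff) auto
      ultimately show "real (card (A1 * A1)) * (2 * (1 + ln (real (card A1))) * (real \<tau> ^ 2 * real (card S)))
          \<le> real P * (2 * L * (real \<tau> ^ 2 * real \<sigma>))"
        using n1 n unfolding \<sigma>_def L_def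
        by (intro mult_mono) auto
    qed
    finally show ?thesis by (simp add: mult_ac)
  qed
  have "\<sigma> * \<tau>\<^sup>2 \<le> 9 * (card (A1 + A1))\<^sup>2" unfolding \<sigma>_def
    using S(6) by (intro solymosi_rich_slopes[OF finA1 A1pos S(1)]) (auto simp: slope_set_def)
  also have "card (A1 + A1) \<le> Q" unfolding Q_def
    using A1 A by (intro card_mono finite_set_plus set_plus_mono2) auto
  finally have sol: "\<sigma> * \<tau>\<^sup>2 \<le> 9 * Q\<^sup>2" by (simp add: power_mono)
  have \<sigma>\<tau>0: "\<sigma> * \<tau>\<^sup>2 > 0" using \<sigma> S(3) by simp
  \<comment> \<open>M is chosen so that 48 Q^2 < M \<sigma> \<tau>^2, against which the cluster
    bound will fail. The \<open>+ 2\<close> ensures M >= 2, and with Solymosi's 9 Q^2 the upper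
    constant is 48 + 2 * 9 = 66.\<close>
  define M where "M = (48 * Q\<^sup>2) div (\<sigma> * \<tau>\<^sup>2) + 2"
  have M2: "M \<ge> 2" by (simp add: M_def)
  have M_le: "M * (\<sigma> * \<tau>\<^sup>2) \<le> 66 * Q\<^sup>2"
    using div_times_less_eq_dividend[of "48 * Q\<^sup>2" "\<sigma> * \<tau>\<^sup>2"] sol
    unfolding M_def add_mult_distrib by linarith
  have M_gt: "48 * Q\<^sup>2 < M * (\<sigma> * \<tau>\<^sup>2)"
    using dividend_less_div_times[OF \<sigma>\<tau>0, of "48 * Q\<^sup>2"] \<sigma>\<tau>0
    unfolding M_def add_mult_distrib by linarith
  have "\<exists>Y. Y \<subseteq> slope_set A1 \<mu> \<and> card Y = \<tau>" if "\<mu> \<in> S" for \<mu>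
    using obtain_subset_with_card_n[OF S(6)[OF that]] by metis
  then obtain X where X: "\<And>\<mu>. \<mu> \<in> S \<Longrightarrow> X \<mu> \<subseteq> slope_set A1 \<mu>" "\<And>\<mu>. \<mu> \<in> S \<Longrightarrow> card (X \<mu>) = \<tau>"
    by metis
  have finX: "finite (X \<mu>)" if "\<mu> \<in> S" for \<mu>
    by (rule finite_subset[OF X(1)[OF that]]) (simp add: finA1)
  have XA1: "x \<in> A1" "\<mu> * x \<in> A1" if "\<mu> \<in> S" "x \<in> X \<mu>" for \<mu> x
    using X(1)[OF that(1)] that(2) by (auto simp: slope_set_def)
  define G where "G = {\<mu>\<in>S. \<exists>\<nu>\<in>S. \<exists>\<xi>\<in>S. \<exists>\<alpha> \<beta> \<gamma>. \<alpha> \<noteq> 0 \<and> \<beta> \<noteq> 0 \<and> \<gamma> \<noteq> 0 \<and>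
    4 * \<tau>\<^sup>2 < M\<^sup>2 * card (linear_triples (X \<mu>) (X \<nu>) (X \<xi>) \<alpha> \<beta> \<gamma>)}"
  have GS: "G \<subseteq> S" by (auto simp: G_def)
  have finG: "finite G" using GS S(1) by (rule finite_subset)
  define g where "g = card G"
  have g\<sigma>: "g \<le> \<sigma>" unfolding g_def \<sigma>_def by (rule card_mono[OF S(1) GS])
  consider "\<sigma> \<le> 2 * g" | "\<sigma> \<le> 2 * M"
  proof (cases "\<sigma> \<le> 2 * g")
    case False
    define N where "N = card (S - G)"
    have N: "N + g = \<sigma>"
      using card_Diff_subset[OF finG GS] g\<sigma> by (simp add: N_def g_def \<sigma>_def)
    have "N < M"
    proof (rule ccontr)
      assume "\<not> N < M"
      then have "1 \<le> N div M" using M2 by (simp add: Suc_le_eq div_greater_zero_iff)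
      moreover have "N < N div M * M + M" using dividend_less_div_times[of M N] M2 by simp
      moreover have "M \<le> N div M * M" using calculation(1) by simp
      ultimately have NM: "N \<le> 2 * (N div M * M)" by linarith
      \<comment> \<open>Slopes outside \<open>G\<close> admit at most 4 \<tau>^2 / M^2 triples, so
        each full cluster has at least M^2 \<tau>^2 / 12 sums.\<close>
      have "N div M * (M\<^sup>2 * \<tau>\<^sup>2) \<le> 12 * (card (A + A))\<^sup>2" unfolding N_def
      proof (rule cluster_partition[OF A(1) Apos])
        fix U assume U: "U \<subseteq> S - G" "card U = M"
        show "M\<^sup>2 * \<tau>\<^sup>2 \<le> 12 * card (cluster_sums X U)"
        proof (rule card_cluster_sums[OF _ U(2) M2])
          show "finite U" using U(1) S(1) by (auto intro: finite_subset)
          show "finite (X \<mu>) \<and> card (X \<mu>) = \<tau>" if "\<mu> \<in> U" for \<mu>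
            using that U(1) finX X(2) by auto
          show "M\<^sup>2 * card (linear_triples (X \<kappa>) (X \<mu>) (X \<nu>) \<alpha> \<beta> \<gamma>) \<le> 4 * \<tau>\<^sup>2"
            if "\<kappa> \<in> U" "\<mu> \<in> U" "\<nu> \<in> U" "\<alpha> \<noteq> 0" "\<beta> \<noteq> 0" "\<gamma> \<noteq> 0" for \<kappa> \<mu> \<nu> \<alpha> \<beta> \<gamma>
          proof (rule ccontr)
            assume "\<not> ?thesis"
            then have "\<kappa> \<in> G" using that U(1) unfolding G_def not_le by blast
            then show False using that U(1) by blast
          qed
        qed
      qed (use S(1) M2 XA1 A1 in auto)
      then have "M * \<tau>\<^sup>2 * (N div M * M) \<le> 12 * Q\<^sup>2"
        by (simp add: Q_def power2_eq_square mult_ac)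
      then have "M * \<tau>\<^sup>2 * N \<le> 24 * Q\<^sup>2"
        using mult_le_mono2[OF NM, of "M * \<tau>\<^sup>2"]
        unfolding mult.left_commute[of "M * \<tau>\<^sup>2" 2] by linarith
      moreover have "M * \<tau>\<^sup>2 * \<sigma> \<le> M * \<tau>\<^sup>2 * (2 * N)"
        using False N by (intro mult_le_mono2) linarith
      moreover have "M * (\<sigma> * \<tau>\<^sup>2) = M * \<tau>\<^sup>2 * \<sigma>" by (simp only: mult_ac)
      \<comment> \<open>M N \<tau>^2 <= 24 Q^2 and \<sigma> <= 2 N give M \<sigma> \<tau>^2 <= 48
        Q^2, against the choice of M.\<close>
      ultimately show False
        using M_gt unfolding mult.left_commute[of "M * \<tau>\<^sup>2" 2] by linarith
    qed
    then show thesis using that False N by linarith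
  qed auto
  then have "real n ^ 399 \<le> sum_product_const * (L ^ 138 * real P ^ 119 * real Q ^ 180)"
  proof cases
    case 1
    then have "G \<noteq> {}" using \<sigma> by (auto simp: g_def)
    define \<Omega> where "\<Omega> \<mu> = {p \<in> popular_products A. \<exists>a\<in>A. \<exists>x\<in>X \<mu>. p = a * x}" for \<mu>
    define \<kappa> where "\<kappa> = 1024 * real M ^ 4 * L * real Q"
    have large: "(real (card A))\<^sup>2 * real \<tau> \<le> \<kappa> * real (card (\<Omega> \<mu>))" if \<mu>: "\<mu> \<in> G" for \<mu>
    proof -
      obtain \<nu> \<xi> \<alpha> \<beta> \<gamma> where *: "\<mu> \<in> S" "\<nu> \<in> S" "\<xi> \<in> S" "\<alpha> \<noteq> 0" "\<beta> \<noteq> 0" "\<gamma> \<noteq> 0"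
        "4 * \<tau>\<^sup>2 < M\<^sup>2 * card (linear_triples (X \<mu>) (X \<nu>) (X \<xi>) \<alpha> \<beta> \<gamma>)"
        using \<mu> unfolding G_def by blast
      have "X \<mu> \<subseteq> popular_part A" using XA1[OF *(1)] by (auto simp: A1_def)
      from many_popular_products[OF A(1) Apos this finX[OF *(2)] finX[OF *(3)] X(2)[OF *(1)] X(2)[OF *(2)]
          X(2)[OF *(3)] S(3) *(4-6) less_imp_le[OF *(7)]]
      show ?thesis by (simp only: \<kappa>_def L_def n_def Q_def \<Omega>_def)
    qed
    obtain b where b: "b \<in> A" and V: "real (card G) * real (card A) ^ 3 * real \<tau>
        \<le> 2 * \<kappa> * real (card (A * A)) * real (\<Sum>a\<in>A. card {\<mu>\<in>G. a * (\<mu> * b) \<in> A * A})"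
    proof (rule popular_dilates[OF A finG _ _ large])
      show "\<Omega> \<mu> \<subseteq> popular_products A" for \<mu> by (auto simp: \<Omega>_def)
      show "\<mu> * p \<in> A * A" if \<mu>: "\<mu> \<in> G" and p: "p \<in> \<Omega> \<mu>" for \<mu> p
      proof -
        obtain a x where ax: "a \<in> A" "x \<in> X \<mu>" "p = a * x" using p by (auto simp: \<Omega>_def)
        have "\<mu> * x \<in> A" using XA1(2)[of \<mu> x] \<mu> GS ax(2) A1 by blast
        then have "a * (\<mu> * x) \<in> A * A" using ax(1) by (intro set_times_intro)
        then show ?thesis using ax(3) by (simp only: mult.left_commute)
      qed
      show "\<kappa> \<ge> 0" using L by (simp add: \<kappa>_def)
    qed blast
    have b0: "b > 0" using b by (rule Apos)
    define R where "R = (\<lambda>\<mu>. \<mu> * b) ` G"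
    define V where "V = (\<Sum>a\<in>A. card {u\<in>R. a * u \<in> A * A})"
    have injR: "inj_on (\<lambda>\<mu>. \<mu> * b) Z" for Z using b0 by (auto simp: inj_on_def)
    have cR: "card R = g" unfolding R_def g_def by (rule card_image[OF injR])
    have "card {u\<in>R. a * u \<in> A * A} = card {\<mu>\<in>G. a * (\<mu> * b) \<in> A * A}" for a
    proof -
      have "{u\<in>R. a * u \<in> A * A} = (\<lambda>\<mu>. \<mu> * b) ` {\<mu>\<in>G. a * (\<mu> * b) \<in> A * A}"
        by (auto simp: R_def)
      then show ?thesis by (simp add: card_image[OF injR])
    qed
    then have V': "real g * real n ^ 3 * real \<tau> \<le> 2 * \<kappa> * real P * real V"
      using V by (simp add: V_def g_def n_def P_def)
    have "\<sigma> \<le> \<tau> * \<sigma>" using S(3) by simp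
    then have gn: "g \<le> n\<^sup>2" using g\<sigma> \<tau>\<sigma> by linarith
    have "real V ^ 19 \<le> 2 ^ 19 * 2304 * 2048 ^ 5 * (L ^ 29 * real g ^ 14 * real P ^ 10 * real Q ^ 9)"
      using dilates_bound[OF A Apos, of R] finG \<open>G \<noteq> {}\<close> b0 S(5) GS cR gn
      by (force simp: V_def L_def n_def P_def Q_def R_def)
    also have "\<dots> \<le> 2 ^ 19 * 2304 * 2048 ^ 5 * (L ^ 29 * real \<sigma> ^ 14 * real P ^ 10 * real Q ^ 9)"
      using g\<sigma> L by (intro mult_left_mono mult_right_mono power_mono) auto
    finally have h5: "real V ^ 19 \<le> 2 ^ 19 * 2304 * 2048 ^ 5 * (L ^ 29 * real \<sigma> ^ 14 * real P ^ 10 * real Q ^ 9)" .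
    have "real \<sigma> * (real n ^ 3 * real \<tau>) \<le> (2 * real g) * (real n ^ 3 * real \<tau>)"
      using 1 by (intro mult_right_mono) auto
    \<comment> \<open>4096 = 2 * 2 * 1024: one factor 2 from the half-average threshold of popular
      products, one from \<sigma> <= 2 g.\<close>
    then have h3: "real \<sigma> * real n ^ 3 * real \<tau> \<le> 4096 * (real M ^ 4 * L * real Q * real P * real V)"
      using V' by (simp add: \<kappa>_def mult_ac)
    have "real n ^ 399 \<le> (512 ^ 90 * (4096 * 66 ^ 4) ^ 19 * (2 ^ 19 * 2304 * 2048 ^ 5)) *
        (L ^ 138 * real P ^ 119 * real Q ^ 180)"
    proof (rule many_good_slopes_algebra[OF _ _ _ _ _ _ _ _ _ _ _ _ h1 _ h3 _ h5])
      have "real (\<tau> * \<sigma>) \<le> real (n\<^sup>2)" using \<tau>\<sigma> by (rule of_nat_mono)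
      then show "real \<tau> * real \<sigma> \<le> (real n)\<^sup>2" by simp
      have "real (M * (\<sigma> * \<tau>\<^sup>2)) \<le> real (66 * Q\<^sup>2)" using M_le by (rule of_nat_mono)
      then show "real M * (real \<sigma> * (real \<tau>)\<^sup>2) \<le> 66 * (real Q)\<^sup>2" by simp
    qed (use n L \<sigma> S(3) in auto)
    also have "\<dots> \<le> sum_product_const * (L ^ 138 * real P ^ 119 * real Q ^ 180)"
      using L by (intro mult_right_mono sum_product_const_bounds(2)) simp
    finally show ?thesis .
  next
    case 2
    \<comment> \<open>Few slopes: \<sigma> <= 2 M and M \<sigma> \<tau>^2 <= 66 Q^2 give (\<tau>
      \<sigma>)^2 <= 132 Q^2 <= (12 Q)^2.\<close>
    have "(\<tau> * \<sigma>)\<^sup>2 = \<sigma> * (\<sigma> * \<tau>\<^sup>2)" by (simp add: power2_eq_square mult_ac)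
    also have "\<dots> \<le> 2 * M * (\<sigma> * \<tau>\<^sup>2)" using 2 by (rule mult_le_mono1)
    also have "\<dots> \<le> (12 * Q)\<^sup>2" using M_le by (simp add: power_mult_distrib)
    finally have "\<tau> * \<sigma> \<le> 12 * Q" by (rule power2_le_imp_le) simp
    then have "real (\<tau> * \<sigma>) \<le> real (12 * Q)" by (rule of_nat_mono)
    then have ts: "real \<tau> * real \<sigma> \<le> 12 * real Q" by simp
    have tn: "real \<tau> \<le> real n" using S(4) cA1 by simp
    have "real n ^ 4 \<le> 512 * (real P * L * (real \<tau> * (real \<tau> * real \<sigma>)))"
      using h1 by (simp add: power2_eq_square mult_ac)
    also have "\<dots> \<le> 512 * (real P * L * (real n * (12 * real Q)))"
      using L by (intro mult_left_mono mult_mono ts tn) auto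
    also have "\<dots> = real n * (6144 * (real P * L * real Q))" by simp
    finally have "real n * real n ^ 3 \<le> real n * (6144 * (real P * L * real Q))"
      by (simp flip: power_Suc)
    then have h: "real n ^ 3 \<le> 6144 * (real P * L * real Q)"
      using n by (simp only: mult_le_cancel_left_pos)
    have "real n ^ 399 \<le> 6144 ^ 119 * (L ^ 138 * real P ^ 119 * real Q ^ 180)"
      using n nQ L by (intro few_slopes_algebra[OF _ _ _ _ _ h]) auto
    also have "\<dots> \<le> sum_product_const * (L ^ 138 * real P ^ 119 * real Q ^ 180)"
      using L by (intro mult_right_mono sum_product_const_bounds(3)) simp
    finally show ?thesis .
  qed
  then show ?thesis by (simp only: n_def L_def P_def Q_def)
qed

text \<open>Pass to the positive or the negated negative elements: negation preserves products of
  two elements and reflects the sumset. As |A| >= 2 and 0 costs at most one element, one part has at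
  least |A| / 4 elements.\<close>

lemma sum_product_real:
  fixes A :: "real set"
  assumes A: "finite A" "card A \<ge> 2"
  shows "real (card A) ^ 399 \<le> 4 ^ 399 * sum_product_const *
    ((1 + ln (real (card A))) ^ 138 * real (card (A * A)) ^ 119 * real (card (A + A)) ^ 180)"
proof -
  have *: ?thesis if B: "B \<subseteq> A \<or> B \<subseteq> uminus ` A" and Bpos: "\<And>b. b \<in> B \<Longrightarrow> b > 0"
    and card: "card A \<le> 4 * card B" for B
  proof -
    have finB: "finite B" using B A(1) by (auto intro: finite_subset)
    have Bne: "B \<noteq> {}" using card A(2) by auto
    have inj: "inj_on uminus Z" for Z :: "real set" by simp
    have "B * B \<subseteq> A * A \<and> card (B + B) \<le> card (A + A)"
      using B
    proof
      assume B: "B \<subseteq> A"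
      then show ?thesis
        using set_times_mono2[OF B B] card_mono[OF finite_set_plus[OF A(1) A(1)] set_plus_mono2[OF B B]]
        by blast
    next
      assume B: "B \<subseteq> uminus ` A"
      then have 1: "uminus ` B \<subseteq> A" by auto
      have "B * B \<subseteq> A * A"
      proof
        fix p assume "p \<in> B * B"
        then obtain x y where "x \<in> B" "y \<in> B" "p = x * y" by (auto elim: set_times_elim)
        then have "p = (- x) * (- y)" "- x \<in> A" "- y \<in> A" using 1 by auto
        then show "p \<in> A * A" using set_times_intro[of "- x" A "- y" A] by simp
      qed
      moreover have "card (B + B) \<le> card (A + A)"
      proof (rule card_inj_on_le[of uminus])
        show "uminus ` (B + B) \<subseteq> A + A"
        proof (rule image_subsetI)
          fix p assume "p \<in> B + B"
          then obtain x y where "x \<in> B" "y \<in> B" "p = x + y" by (auto elim: set_plus_elim)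
          then have "- p = (- x) + (- y)" "- x \<in> A" "- y \<in> A" using 1 by auto
          then show "- p \<in> A + A" using set_plus_intro[of "- x" A "- y" A] by simp
        qed
      qed (use A(1) in \<open>auto intro: finite_set_plus\<close>)
      ultimately show ?thesis by blast
    qed
    then have PQ: "card (B * B) \<le> card (A * A)" "card (B + B) \<le> card (A + A)"
      using A(1) by (auto intro: card_mono finite_set_times)
    have cB: "card B \<ge> 1" using finB Bne by (simp add: Suc_le_eq card_gt_0_iff)
    have "card B \<le> card A"
      using B A(1) card_mono card_image[OF inj, of A] by (metis finite_imageI)
    then have ln: "ln (real (card B)) \<le> ln (real (card A))" using cB by (subst ln_le_cancel_iff) auto
    have c0: "sum_product_const \<ge> 0" using sum_product_const_bounds(1) by simp
    have "real (card A) ^ 399 \<le> (4 * real (card B)) ^ 399"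
      using card by (intro power_mono) (simp_all add: of_nat_mono)
    also have "\<dots> = 4 ^ 399 * real (card B) ^ 399" by (rule power_mult_distrib)
    also have "\<dots> \<le> 4 ^ 399 * (sum_product_const * ((1 + ln (real (card B))) ^ 138 *
        real (card (B * B)) ^ 119 * real (card (B + B)) ^ 180))"
      by (intro mult_left_mono sum_product_positive[OF finB Bne Bpos]) auto
    also have "\<dots> \<le> 4 ^ 399 * (sum_product_const * ((1 + ln (real (card A))) ^ 138 *
        real (card (A * A)) ^ 119 * real (card (A + A)) ^ 180))"
      using c0 PQ ln cB by (intro mult_left_mono mult_mono power_mono) auto
    finally show ?thesis by (simp only: mult.assoc)
  qed
  define B where "B = {a\<in>A. a > 0}"
  define C where "C = {a\<in>A. a < 0}"
  have "A \<subseteq> (B \<union> C) \<union> {0}" by (auto simp: B_def C_def)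
  then have "card A \<le> card ((B \<union> C) \<union> {0})"
    using A(1) by (intro card_mono) (auto simp: B_def C_def)
  also have "\<dots> \<le> card B + card C + 1"
    using card_Un_le[of "B \<union> C" "{0}"] card_Un_le[of B C] by simp
  finally consider "card A \<le> 4 * card B" | "card A \<le> 4 * card C" using A(2) by linarith
  then show ?thesis
  proof cases
    case 1
    then show ?thesis by (intro *[of B]) (auto simp: B_def)
  next
    case 2
    then show ?thesis by (intro *[of "uminus ` C"]) (auto simp: C_def card_image)
  qed
qed

text \<open>Take the 299th root of \<open>sum_product_real\<close>: 119 + 180 = 299, and 399 / 299
  exceeds the claimed exponent. For a single element the right-hand side would vanish because ln 1 =
  0, hence the restriction to at least two.\<close>

theorem theorem1p2:
  "\<exists>c>0. \<exists>C>0. \<forall>A :: real set. finite A \<longrightarrow> card A \<ge> 2 \<longrightarrow>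
     real (card A) powr (4/3 + 5/5277)
       \<le> C * ((real (card (A * A)) + real (card (A + A))) * ln (real (card A)) powr c)"
proof -
  define k where "k = 4 ^ 399 * sum_product_const"
  have k: "k > 0" unfolding k_def
    by (intro mult_pos_pos zero_less_power zero_less_numeral sum_product_const_bounds(1))
  define K where "K = k * (1 / ln 2 + 1) ^ 138"
  have "1 / ln 2 + 1 > (0::real)" by (intro add_pos_pos) auto
  then have K: "K > 0" using k by (simp add: K_def)
  have "real (card A) powr (4/3 + 5/5277)
       \<le> K powr (1/299) * ((real (card (A * A)) + real (card (A + A))) * ln (real (card A)) powr (138/299))"
    if A: "finite A" "card A \<ge> 2" for A :: "real set"
  proof -
    define n where "n = real (card A)"
    define s where "s = real (card (A * A)) + real (card (A + A))"
    have n: "n \<ge> 2" using A by (simp add: n_def)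
    have ln2: "ln 2 > (0::real)" by simp
    have lnn: "ln n \<ge> ln 2" using n by simp
    have lnpos: "ln n > 0" using n by simp
    have "card A \<le> card (A + A)" using A by (intro card_le_card_sumset) auto
    then have s: "s > 0" using n by (simp add: s_def n_def)
    \<comment> \<open>Since n >= 2, the additive 1 in the logarithmic factor is absorbed into a
      multiple of ln n.\<close>
    have "1 \<le> 1 / ln 2 * ln n" using lnn ln2 by (simp add: field_simps)
    then have L: "1 + ln n \<le> (1 / ln 2 + 1) * ln n" by (simp add: distrib_right)
    have "n ^ 399 \<le> k *
        ((1 + ln n) ^ 138 * real (card (A * A)) ^ 119 * real (card (A + A)) ^ 180)"
      unfolding n_def k_def by (rule sum_product_real[OF A])
    also have "\<dots> \<le> k *
        (((1 / ln 2 + 1) * ln n) ^ 138 * s ^ 119 * s ^ 180)"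
      using L k lnpos s by (intro mult_left_mono mult_mono power_mono) (auto simp: s_def)
    also have "\<dots> = K * (ln n ^ 138 * (s ^ 119 * s ^ 180))"
      by (simp only: K_def power_mult_distrib mult_ac)
    also have "\<dots> = K * (ln n ^ 138 * s ^ 299)" by (simp flip: power_add)
    finally have main: "n ^ 399 \<le> K * (ln n ^ 138 * s ^ 299)" .
    have root: "(x ^ m) powr (1/299) = x powr (real m / 299)" if "x > 0" for x :: real and m
      using that powr_realpow[of x m] powr_powr[of x "real m" "1/299"] by simp
    have "n powr (4/3 + 5/5277) \<le> n powr (399/299)"
      using n by (intro powr_mono) auto
    also have "\<dots> = (n ^ 399) powr (1/299)"
      using n root[of n 399] by simp
    also have "\<dots> \<le> (K * (ln n ^ 138 * s ^ 299)) powr (1/299)"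
      using n by (intro powr_mono2 main) simp_all
    also have "\<dots> = K powr (1/299) * ((ln n ^ 138) powr (1/299) * (s ^ 299) powr (1/299))"
      using K lnpos s by (simp add: powr_mult)
    also have "(ln n ^ 138) powr (1/299) = ln n powr (138/299)"
      using lnpos root[of "ln n" 138] by simp
    also have "(s ^ 299) powr (1/299) = s"
      using s root[of s 299] by simp
    finally show ?thesis by (simp add: n_def s_def mult_ac)
  qed
  moreover have "K powr (1/299) > 0" "(138/299 :: real) > 0" using K by auto
  ultimately show ?thesis by blast
qed

end
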